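(* If $(X,\mathfrak S)$ is a hierarchically hyperbolic space, and $\sigma$ is the metric on $X$ defined in the context, then $(X,\sigma)$ is coarsely injective, hence roughly geodesic.
   Context: Coarsely injective: a metric space $(X,\sigma)$ is coarsely injective if there is $\delta\ge 0$ such that for any family $\{B(x_i,r_i):i\in I\}$ of balls with $\sigma(x_i,x_j)\le r_i+r_j$ for all $i,j\in I$, the $\delta$-neighbourhoods of those balls have nonempty total intersection. Roughly geodesic: there is $C\ge0$ such that any $a,b\in X$ are joined by a $(1,C)$-quasi-isometric embedding $f:[0,\sigma(a,b)]\to X$ with $f(0)=a$, $f(\sigma(a,b))=b$. Hierarchically hyperbolic space (HHS). A quasigeodesic metric space $(X,d)$ is an HHS, written $(X,\mathfrak S)$, if there are a constant $E\ge 1$, a set $\mathfrak S$ (of "domains"), and for each $U\in\mathfrak S$ a geodesic $E$-hyperbolic space $\mathcal CU$, with the following. Write $d_U(x,y)=d_{\mathcal CU}(\pi_U(x),\pi_U(y))$ for $x,y\in X$, and similarly for subsets of $X$ or $\mathcal CU$; distances between sets are infima. (It is a standing convention that $X$ is moreover a geodesic space, e.g. a graph.) (1) Projections: for each $U$ there is an $E$-coarsely onto, $(E,E)$-coarsely Lipschitz map $\pi_U:X\to\mathcal CU$. (2) Nesting: $\mathfrak S$ has a partial order $\sqsubseteq$ with a unique maximal element (if $\mathfrak S\ne\emptyset$). If $U\sqsubsetneq V$ there are a nonempty set $\rho^U_V\subset\mathcal CV$ of diameter at most $E$ and a map $\rho^V_U:\mathcal CV\to\mathcal CU$. (3) Orthogonality: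 there is a symmetric, anti-reflexive relation $\bot$ on $\mathfrak S$; if $U\sqsubseteq V$ and $V\bot W$ then $U\bot W$; orthogonal domains are not $\sqsubseteq$-comparable; for each $T\in\mathfrak S$ and $U\sqsubseteq T$ such that some $V\sqsubseteq T$ has $V\bot U$, there is $W\sqsubsetneq T$ such that every $V\sqsubseteq T$ with $V\bot U$ satisfies $V\sqsubseteq W$. (4) Transversality and consistency: $U,V$ are transverse, $U\pitchfork V$, if they are neither orthogonal nor $\sqsubseteq$-comparable; then there are nonempty sets $\rho^U_V\subset\mathcal CV$, $\rho^V_U\subset\mathcal CU$ of diameter at most $E$ with $\min\{d_U(x,\rho^V_U),d_V(x,\rho^U_V)\}\le E$ for all $x\in X$. If $U\sqsubsetneq V$ then $\min\{d_V(x,\rho^U_V),\operatorname{diam}(\{\pi_U(x)\}\cup\rho^V_U(\pi_V(x)))\}\le E$ for all $x\in X$. If $U\sqsubseteq V$, then $d_W(\rho^U_W,\rho^V_W)\le E$ whenever $V\sqsubsetneq W$, or $V\pitchfork W$ and $W\not\perp U$. (5) Finite complexity: the cardinalities of sets of pairwise $\sqsubseteq$-comparable domains are at most $E$. (6) Large links: for $W\in\mathfrak S$ and $x,x'\in X$, put $N=E\,d_W(x,x')+E$. There are $T_1,\dots,T_{\lfloor N\rfloor}\sqsubsetneq W$ such that every $T\sqsubsetneq W$ satisfies $T\sqsubseteq T_i$ for some $i$ or $d_T(x,x')<E$; and $d_W(x,\rho^{T_i}_W)\le N$ for all $i$. (7) Bounded geodesic image: if $U\sqsubsetneq V$ and $\gamma\subset\mathcal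 CV$ is a geodesic with $d_V(\gamma,\rho^U_V)>E$, then $\operatorname{diam}\rho^V_U(\gamma)\le E$. (8) Partial realisation: if $\{U_i\}$ is a set of pairwise orthogonal domains and $p_i\in\mathcal CU_i$, there is $x\in X$ with $d_{U_i}(x,p_i)\le E$ for all $i$ and $d_V(x,\rho^{U_i}_V)\le E$ whenever $U_i\sqsubsetneq V$ or $U_i\pitchfork V$. (9) Uniqueness: for each $\kappa\ge0$ there is $\theta(\kappa)$ such that if $d(x,y)\ge\theta(\kappa)$ then $d_V(x,y)\ge\kappa$ for some $V\in\mathfrak S$. Coarse median on an HHS. For $x,y,z\in X$ let $m_U$ be a (coarse) median of $\pi_U(x),\pi_U(y),\pi_U(z)$ in the hyperbolic space $\mathcal CU$. By the realisation theorem for HHSs there is a point $\mu(x,y,z)\in X$ with $d_U(\mu(x,y,z),m_U)$ uniformly bounded over all $U\in\mathfrak S$ and all $x,y,z$; this defines $\mu:X^3\to X$, making $(X,\mu,d)$ a coarse median space. One may take $\mu$ symmetric with $\mu(x,x,y)=x$. The metric $\sigma$. Fix $K>0$. A $K$-contraction is a map $\Phi:X\to\mathbb R$ with $|\Phi(x)-\Phi(y)|\le d(x,y)+K$ and $|\Phi(\mu(x,y,z))-\mu_{\mathbb R}(\Phi(x),\Phi(y),\Phi(z))|\le K$ for all $x,y,z\in X$, where $\mu_{\mathbb R}$ is the standard median on $\mathbb R$. Then $\sigma(a,b)$ is the supremum of all $r\ge0$ for which there is a $K$-contraction $\Phi$ with $\Phi(a)=0$ and $\Phi(b)=r$. *)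

theory Defs
  imports "HOL-Analysis.Analysis"
begin

section \<open>Coarse metric geometry\<close>

definition geodesic_segment ::
    "'a set \<Rightarrow> ('a \<Rightarrow> 'a \<Rightarrow> real) \<Rightarrow> 'a \<Rightarrow> 'a \<Rightarrow> 'a set \<Rightarrow> bool" where
  "geodesic_segment M d a b S \<longleftrightarrow>
     (\<exists>\<gamma>::real \<Rightarrow> 'a.
        (\<forall>t\<in>{0..d a b}. \<gamma> t \<in> M) \<and>
        (\<forall>s\<in>{0..d a b}. \<forall>t\<in>{0..d a b}. d (\<gamma> s) (\<gamma> t) = \<bar>s - t\<bar>) \<and>
        \<gamma> 0 = a \<and> \<gamma> (d a b) = b \<and> S = \<gamma> ` {0..d a b})"

definition geodesic_space :: "'a set \<Rightarrow> ('a \<Rightarrow> 'a \<Rightarrow> real) \<Rightarrow> bool" where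
  "geodesic_space M d \<longleftrightarrow>
     Metric_space M d \<and> (\<forall>a\<in>M. \<forall>b\<in>M. \<exists>S. geodesic_segment M d a b S)"

text \<open>\<open>(l, c)\<close>-quasi-isometric embeddings of the real interval \<open>{0..T}\<close>.\<close>

definition qi_embedded_interval ::
    "real \<Rightarrow> real \<Rightarrow> 'a set \<Rightarrow> ('a \<Rightarrow> 'a \<Rightarrow> real) \<Rightarrow> real \<Rightarrow> (real \<Rightarrow> 'a) \<Rightarrow> bool" where
  "qi_embedded_interval l c M d T f \<longleftrightarrow>
     (\<forall>t\<in>{0..T}. f t \<in> M) \<and>
     (\<forall>s\<in>{0..T}. \<forall>t\<in>{0..T}.
        \<bar>s - t\<bar> / l - c \<le> d (f s) (f t) \<and> d (f s) (f t) \<le> l * \<bar>s - t\<bar> + c)"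

definition quasigeodesic_space :: "'a set \<Rightarrow> ('a \<Rightarrow> 'a \<Rightarrow> real) \<Rightarrow> bool" where
  "quasigeodesic_space M d \<longleftrightarrow>
     Metric_space M d \<and>
     (\<exists>l\<ge>1. \<exists>c\<ge>0. \<forall>a\<in>M. \<forall>b\<in>M. \<exists>T\<ge>0. \<exists>f.
        qi_embedded_interval l c M d T f \<and> f 0 = a \<and> f T = b)"

definition roughly_geodesic :: "'a set \<Rightarrow> ('a \<Rightarrow> 'a \<Rightarrow> real) \<Rightarrow> bool" where
  "roughly_geodesic M d \<longleftrightarrow>
     Metric_space M d \<and>
     (\<exists>C\<ge>0. \<forall>a\<in>M. \<forall>b\<in>M. \<exists>f.
        qi_embedded_interval 1 C M d (d a b) f \<and> f 0 = a \<and> f (d a b) = b)"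

definition thickening :: "'a set \<Rightarrow> ('a \<Rightarrow> 'a \<Rightarrow> real) \<Rightarrow> real \<Rightarrow> 'a set \<Rightarrow> 'a set" where
  "thickening M d \<delta> S = {z \<in> M. \<exists>y\<in>S. d z y \<le> \<delta>}"

text \<open>A family of balls enters only through its set \<open>A\<close> of pairs (centre, radius), so
  quantifying over sets of pairs covers families over arbitrary index sets. Balls are closed;
  applying the hypothesis to a pair and itself shows that all radii are nonnegative.\<close>

definition coarsely_injective :: "'a set \<Rightarrow> ('a \<Rightarrow> 'a \<Rightarrow> real) \<Rightarrow> bool" where
  "coarsely_injective M d \<longleftrightarrow>
     Metric_space M d \<and>
     (\<exists>\<delta>\<ge>0. \<forall>A :: ('a \<times> real) set.
        (\<forall>(x, r)\<in>A. x \<in> M) \<and> (\<forall>(x, r)\<in>A. \<forall>(y, s)\<in>A. d x y \<le> r + s) \<longrightarrow>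
        (\<exists>z\<in>M. \<forall>(x, r)\<in>A. z \<in> thickening M d \<delta> (Metric_space.mcball M d x r)))"

text \<open>Hyperbolicity of a geodesic space via slim triangles.\<close>

definition geodesic_hyperbolic :: "real \<Rightarrow> 'a set \<Rightarrow> ('a \<Rightarrow> 'a \<Rightarrow> real) \<Rightarrow> bool" where
  "geodesic_hyperbolic E M d \<longleftrightarrow>
     geodesic_space M d \<and>
     (\<forall>a\<in>M. \<forall>b\<in>M. \<forall>c\<in>M. \<forall>P Q R.
        geodesic_segment M d a b P \<and> geodesic_segment M d b c Q \<and> geodesic_segment M d c a R \<longrightarrow>
        (\<forall>p\<in>P. \<exists>q\<in>Q \<union> R. d p q \<le> E))"

text \<open>A coarse median of three points of a hyperbolic space: a point close to all three sides of
  a geodesic triangle spanned by them.\<close>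

definition coarse_triangle_median ::
    "real \<Rightarrow> 'a set \<Rightarrow> ('a \<Rightarrow> 'a \<Rightarrow> real) \<Rightarrow> 'a \<Rightarrow> 'a \<Rightarrow> 'a \<Rightarrow> 'a \<Rightarrow> bool" where
  "coarse_triangle_median \<kappa> M d a b c m \<longleftrightarrow>
     m \<in> M \<and>
     (\<exists>P Q R. geodesic_segment M d a b P \<and> geodesic_segment M d b c Q \<and>
        geodesic_segment M d c a R \<and>
        (\<forall>S\<in>{P, Q, R}. \<exists>p\<in>S. d m p \<le> \<kappa>))"

definition set_dist :: "('a \<Rightarrow> 'a \<Rightarrow> real) \<Rightarrow> 'a set \<Rightarrow> 'a set \<Rightarrow> real" where
  "set_dist d A B = Inf {d a b | a b. a \<in> A \<and> b \<in> B}"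

text \<open>Stated pointwise since the real supremum is only meaningful for bounded sets.\<close>

definition diam_le :: "('a \<Rightarrow> 'a \<Rightarrow> real) \<Rightarrow> 'a set \<Rightarrow> real \<Rightarrow> bool" where
  "diam_le d A r \<longleftrightarrow> (\<forall>a\<in>A. \<forall>b\<in>A. d a b \<le> r)"


section \<open>Hierarchically hyperbolic spaces\<close>

text \<open>
  The space \<open>X\<close> is the type \<open>'x\<close> with its metric \<open>dist\<close>. All hyperbolic spaces \<open>C U\<close> are carriers,
  with metrics \<open>dC U\<close>, inside one type \<open>'c\<close>.
  \<^item> \<open>\<rho> U V\<close> is the subset $\rho^U_V$ of \<open>C V\<close>, for \<open>U\<close> properly nested in or transverse to \<open>V\<close>;
  \<^item> \<open>\<rho>map V U\<close> is the map $\rho^V_U$ from \<open>C V\<close> to \<open>C U\<close>, for \<open>U\<close> properly nested in \<open>V\<close>.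
\<close>

locale hhs_data =
  fixes E :: real
    and \<SS> :: "'s set"
    and nest :: "'s \<Rightarrow> 's \<Rightarrow> bool" (infix "\<sqsubseteq>" 50)
    and orth :: "'s \<Rightarrow> 's \<Rightarrow> bool" (infix "\<bottom>" 50)
    and C :: "'s \<Rightarrow> 'c set"
    and dC :: "'s \<Rightarrow> 'c \<Rightarrow> 'c \<Rightarrow> real"
    and \<pi> :: "'s \<Rightarrow> 'x::metric_space \<Rightarrow> 'c"
    and \<rho> :: "'s \<Rightarrow> 's \<Rightarrow> 'c set"
    and \<rho>map :: "'s \<Rightarrow> 's \<Rightarrow> 'c \<Rightarrow> 'c"
begin

definition proper_nest :: "'s \<Rightarrow> 's \<Rightarrow> bool" (infix "\<sqsubset>" 50) where
  "U \<sqsubset> V \<longleftrightarrow> U \<sqsubseteq> V \<and> U \<noteq> V"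

definition transverse :: "'s \<Rightarrow> 's \<Rightarrow> bool" where
  "transverse U V \<longleftrightarrow>
     U \<in> \<SS> \<and> V \<in> \<SS> \<and> \<not> U \<bottom> V \<and> \<not> U \<sqsubseteq> V \<and> \<not> V \<sqsubseteq> U"

definition proj_dist :: "'s \<Rightarrow> 'x \<Rightarrow> 'x \<Rightarrow> real" where
  "proj_dist U x y = dC U (\<pi> U x) (\<pi> U y)"

definition proj_set_dist :: "'s \<Rightarrow> 'x \<Rightarrow> 'c set \<Rightarrow> real" where
  "proj_set_dist U x A = set_dist (dC U) {\<pi> U x} A"

end

text \<open>In the large links axiom, \<open>\<T>\<close> is the set of the domains $T_1,\dots,T_{\lfloor N\rfloor}$.
  Repetitions being allowed, it has at most $\lfloor N\rfloor$ elements; it must also be allowed to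
  be empty, because $\lfloor N\rfloor \geq 1$ always holds while a minimal \<open>W\<close> has no properly
  nested domains.\<close>

locale hhs = hhs_data E \<SS> nest orth C dC \<pi> \<rho> \<rho>map
  for E :: real
    and \<SS> :: "'s set"
    and nest :: "'s \<Rightarrow> 's \<Rightarrow> bool" (infix "\<sqsubseteq>" 50)
    and orth :: "'s \<Rightarrow> 's \<Rightarrow> bool" (infix "\<bottom>" 50)
    and C :: "'s \<Rightarrow> 'c set"
    and dC :: "'s \<Rightarrow> 'c \<Rightarrow> 'c \<Rightarrow> real"
    and \<pi> :: "'s \<Rightarrow> 'x::metric_space \<Rightarrow> 'c"
    and \<rho> :: "'s \<Rightarrow> 's \<Rightarrow> 'c set"
    and \<rho>map :: "'s \<Rightarrow> 's \<Rightarrow> 'c \<Rightarrow> 'c" +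
  assumes quasigeodesic: "quasigeodesic_space (UNIV :: 'x set) dist"
    and E_ge_1: "E \<ge> 1"
    and hyperbolic: "\<And>U. U \<in> \<SS> \<Longrightarrow> geodesic_hyperbolic E (C U) (dC U)"
    and proj_in: "\<And>U x. U \<in> \<SS> \<Longrightarrow> \<pi> U x \<in> C U"
    and proj_coarsely_onto: "\<And>U p. U \<in> \<SS> \<Longrightarrow> p \<in> C U \<Longrightarrow> \<exists>x. dC U p (\<pi> U x) \<le> E"
    and proj_coarsely_Lipschitz: "\<And>U x y. U \<in> \<SS> \<Longrightarrow> proj_dist U x y \<le> E * dist x y + E"
    and nest_partial_order: "partial_order_on \<SS> {(U, V). U \<sqsubseteq> V}"
    and unique_maximal: "\<SS> \<noteq> {} \<Longrightarrow> \<exists>!S. S \<in> \<SS> \<and> (\<forall>U\<in>\<SS>. S \<sqsubseteq> U \<longrightarrow> U = S)"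
    and nest_rho: "\<And>U V. U \<sqsubset> V \<Longrightarrow> \<rho> U V \<noteq> {} \<and> \<rho> U V \<subseteq> C V \<and> diam_le (dC V) (\<rho> U V) E"
    and nest_rho_map: "\<And>U V. U \<sqsubset> V \<Longrightarrow> \<rho>map V U \<in> C V \<rightarrow> C U"
    and orth_domains: "\<And>U V. U \<bottom> V \<Longrightarrow> U \<in> \<SS> \<and> V \<in> \<SS>"
    and orth_sym: "\<And>U V. U \<bottom> V \<Longrightarrow> V \<bottom> U"
    and orth_antirefl: "\<And>U. \<not> U \<bottom> U"
    and orth_nest: "\<And>U V W. U \<sqsubseteq> V \<Longrightarrow> V \<bottom> W \<Longrightarrow> U \<bottom> W"
    and orth_not_comparable: "\<And>U V. U \<bottom> V \<Longrightarrow> \<not> U \<sqsubseteq> V \<and> \<not> V \<sqsubseteq> U"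
    and orth_container:
      "\<And>T U. U \<sqsubseteq> T \<Longrightarrow> \<exists>V. V \<sqsubseteq> T \<and> V \<bottom> U \<Longrightarrow>
         \<exists>W. W \<sqsubset> T \<and> (\<forall>V. V \<sqsubseteq> T \<and> V \<bottom> U \<longrightarrow> V \<sqsubseteq> W)"
    and transverse_rho:
      "\<And>U V. transverse U V \<Longrightarrow> \<rho> U V \<noteq> {} \<and> \<rho> U V \<subseteq> C V \<and> diam_le (dC V) (\<rho> U V) E"
    and transverse_consistency:
      "\<And>U V x. transverse U V \<Longrightarrow>
         min (proj_set_dist U x (\<rho> V U)) (proj_set_dist V x (\<rho> U V)) \<le> E"
    and nest_consistency:
      "\<And>U V x. U \<sqsubset> V \<Longrightarrow>
         proj_set_dist V x (\<rho> U V) \<le> E \<or>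
         diam_le (dC U) ({\<pi> U x} \<union> {\<rho>map V U (\<pi> V x)}) E"
    and rho_consistency:
      "\<And>U V W. U \<sqsubseteq> V \<Longrightarrow> V \<sqsubset> W \<or> (transverse V W \<and> \<not> W \<bottom> U) \<Longrightarrow>
         set_dist (dC W) (\<rho> U W) (\<rho> V W) \<le> E"
    and finite_complexity:
      "\<And>A. A \<subseteq> \<SS> \<Longrightarrow> \<forall>U\<in>A. \<forall>V\<in>A. U \<sqsubseteq> V \<or> V \<sqsubseteq> U \<Longrightarrow> finite A \<and> real (card A) \<le> E"
    and large_links:
      "\<And>W x x' N. W \<in> \<SS> \<Longrightarrow> N = E * proj_dist W x x' + E \<Longrightarrow>
         \<exists>\<T>. finite \<T> \<and> int (card \<T>) \<le> \<lfloor>N\<rfloor> \<and> (\<forall>T\<in>\<T>. T \<sqsubset> W) \<and>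
             (\<forall>T. T \<sqsubset> W \<longrightarrow> (\<exists>T'\<in>\<T>. T \<sqsubseteq> T') \<or> proj_dist T x x' < E) \<and>
             (\<forall>T\<in>\<T>. proj_set_dist W x (\<rho> T W) \<le> N)"
    and bounded_geodesic_image:
      "\<And>U V p q \<gamma>. U \<sqsubset> V \<Longrightarrow> p \<in> C V \<Longrightarrow> q \<in> C V \<Longrightarrow>
         geodesic_segment (C V) (dC V) p q \<gamma> \<Longrightarrow>
         set_dist (dC V) \<gamma> (\<rho> U V) > E \<Longrightarrow> diam_le (dC U) (\<rho>map V U ` \<gamma>) E"
    and partial_realisation:
      "\<And>A p. A \<subseteq> \<SS> \<Longrightarrow> pairwise (\<bottom>) A \<Longrightarrow> \<forall>U\<in>A. p U \<in> C U \<Longrightarrow>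
         \<exists>x. \<forall>U\<in>A. dC U (\<pi> U x) (p U) \<le> E \<and>
             (\<forall>V. U \<sqsubset> V \<or> transverse U V \<longrightarrow> proj_set_dist V x (\<rho> U V) \<le> E)"
    and uniqueness:
      "\<And>\<kappa>. \<kappa> \<ge> 0 \<Longrightarrow> \<exists>\<theta>. \<forall>x y. dist x y \<ge> \<theta> \<longrightarrow> (\<exists>V\<in>\<SS>. proj_dist V x y \<ge> \<kappa>)"


section \<open>The coarse median and the metric \<open>\<sigma>\<close>\<close>

text \<open>\<open>\<mu>\<close> is a coarse median operation on the space if \<open>\<mu> x y z\<close> realises, with constants uniform
  over all domains and all points, coarse medians \<open>m U x y z\<close> of the projections. It is only determined
  up to bounded error. It is not required to be symmetric or to satisfy \<open>\<mu> x x y = x\<close>, although it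
  may always be chosen that way.\<close>

definition (in hhs_data) hhs_coarse_median :: "('x \<Rightarrow> 'x \<Rightarrow> 'x \<Rightarrow> 'x) \<Rightarrow> bool" where
  "hhs_coarse_median \<mu> \<longleftrightarrow>
     (\<exists>\<kappa> m. \<forall>U\<in>\<SS>. \<forall>x y z.
        coarse_triangle_median \<kappa> (C U) (dC U) (\<pi> U x) (\<pi> U y) (\<pi> U z) (m U x y z) \<and>
        dC U (\<pi> U (\<mu> x y z)) (m U x y z) \<le> \<kappa>)"

definition real_median :: "real \<Rightarrow> real \<Rightarrow> real \<Rightarrow> real" where
  "real_median a b c = max (min a b) (min (max a b) c)"

definition K_contraction ::
    "real \<Rightarrow> ('x::metric_space \<Rightarrow> 'x \<Rightarrow> 'x \<Rightarrow> 'x) \<Rightarrow> ('x \<Rightarrow> real) \<Rightarrow> bool" where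
  "K_contraction K \<mu> \<Phi> \<longleftrightarrow>
     (\<forall>x y. \<bar>\<Phi> x - \<Phi> y\<bar> \<le> dist x y + K) \<and>
     (\<forall>x y z. \<bar>\<Phi> (\<mu> x y z) - real_median (\<Phi> x) (\<Phi> y) (\<Phi> z)\<bar> \<le> K)"

text \<open>For \<open>K > 0\<close> the supremum is over a nonempty set (it contains 0) bounded above by
  \<open>dist a b + K\<close>.\<close>

definition contraction_metric ::
    "real \<Rightarrow> ('x::metric_space \<Rightarrow> 'x \<Rightarrow> 'x \<Rightarrow> 'x) \<Rightarrow> 'x \<Rightarrow> 'x \<Rightarrow> real" where
  "contraction_metric K \<mu> a b =
     Sup {r. r \<ge> 0 \<and> (\<exists>\<Phi>. K_contraction K \<mu> \<Phi> \<and> \<Phi> a = 0 \<and> \<Phi> b = r)}"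

end

theory Submission
  imports Defs
begin

text \<open>
  All the geometry takes place in the pseudometrics that \<open>X\<close> inherits from the spaces \<open>C U\<close>; they
  satisfy Gromov's four point inequality, and \<open>\<mu> x y z\<close> lies coarsely between any two of its
  arguments in each of them.

  Coarse Helly property. Given a bounded family of pairwise intersecting median quasiconvex sets, project
  a base point in every \<open>C U\<close> to the farthest set. Any two coordinates of the resulting tuple are realised
  by a point of \<open>X\<close>, hence so are finitely many, by taking medians. Consistency of transverse domains
  shows that being near the tuple in one coordinate often forces being near it in another one; the
  coordinates which are not forced by others are pairwise nested or orthogonal, so their number is
  bounded. Thus boundedly many coordinates control all others, which gives a point \<open>z\<close> realising the whole
  tuple, and by iterated medians a point of each of the sets at bounded distance from \<open>z\<close>. For a
  single set this is the gate of the base point.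

  The metric \<open>\<sigma>\<close>. Its balls are median quasiconvex. If the gate \<open>g\<close> of \<open>b\<close> in the ball of radius \<open>r\<close> about
  \<open>a\<close> were much further from \<open>b\<close> than \<open>\<sigma> a b - r\<close>, a contraction separating \<open>g\<close> from \<open>b\<close> could
  be glued to one separating \<open>a\<close> from the gate of \<open>a\<close> in a superlevel set of the former. Leaving a gap
  between the regions where the two functions vary makes the result a contraction with the same
  constant \<open>K\<close>, whose oscillation between \<open>a\<close> and \<open>b\<close> exceeds \<open>\<sigma> a b\<close>. Hence balls whose radii add
  up to the distance of the centres intersect coarsely, the coarse Helly property applies to balls, and
  \<open>r \<mapsto> g\<close> is a rough geodesic.
\<close>

subsection \<open>Hyperbolic pseudometrics with a coarse median\<close>

text \<open>The third argument is arbitrary: \<open>\<mu> x y z\<close> lies coarsely between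
  \<open>x\<close> and \<open>y\<close>, so one step joins a set by coarse intervals. Finite
  iterates stand in for a median convex hull.\<close>

definition median_join :: "('x \<Rightarrow> 'x \<Rightarrow> 'x \<Rightarrow> 'x) \<Rightarrow> 'x set \<Rightarrow> 'x set" where
  "median_join \<mu> A = A \<union> {\<mu> x y z | x y z. x \<in> A \<and> y \<in> A}"

lemma median_join_median: "x \<in> A \<Longrightarrow> y \<in> A \<Longrightarrow> \<mu> x y z \<in> median_join \<mu> A"
  unfolding median_join_def by blast

lemma median_join_funpow_mono:
  assumes "k \<le> n"
  shows "(median_join \<mu> ^^ k) A \<subseteq> (median_join \<mu> ^^ n) A"
  using assms by (induction n rule: dec_induct) (auto simp: median_join_def)

lemma median_join_induct:
  assumes "q \<in> (median_join \<mu> ^^ n) A"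
    and "\<And>x. x \<in> A \<Longrightarrow> P 0 x"
    and "\<And>k x. P k x \<Longrightarrow> P (Suc k) x"
    and "\<And>k x y z. P k x \<Longrightarrow> P k y \<Longrightarrow> P (Suc k) (\<mu> x y z)"
  shows "P n q"
  using assms(1)
proof (induction n arbitrary: q)
  case 0
  then show ?case using assms(2) by simp
next
  case (Suc n)
  from Suc.prems have "q \<in> (median_join \<mu> ^^ n) A \<or>
      (\<exists>x y z. q = \<mu> x y z \<and> x \<in> (median_join \<mu> ^^ n) A \<and> y \<in> (median_join \<mu> ^^ n) A)"
    unfolding funpow.simps comp_apply by (subst (asm) median_join_def) blast
  then show ?case using Suc.IH assms(3,4) by blast
qed

text \<open>Betweenness is required for each pair of arguments separately because
  \<open>\<mu>\<close> need not be symmetric.\<close>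

locale hyperbolic_median =
  fixes d :: "'x \<Rightarrow> 'x \<Rightarrow> real" and \<mu> :: "'x \<Rightarrow> 'x \<Rightarrow> 'x \<Rightarrow> 'x" and \<kappa> :: real
  assumes nonneg: "0 \<le> d x y"
    and refl: "d x x = 0"
    and sym: "d x y = d y x"
    and triangle: "d x z \<le> d x y + d y z"
    and four_point: "d a b + d p q \<le> max (d a p + d b q) (d a q + d b p) + \<kappa>"
    and med12: "d x (\<mu> x y z) + d (\<mu> x y z) y \<le> d x y + \<kappa>"
    and med23: "d y (\<mu> x y z) + d (\<mu> x y z) z \<le> d y z + \<kappa>"
    and med13: "d x (\<mu> x y z) + d (\<mu> x y z) z \<le> d x z + \<kappa>"
begin

section \<open>Coarse betweenness, hulls and nearest points in one coordinate\<close>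

definition between :: "real \<Rightarrow> 'x \<Rightarrow> 'x \<Rightarrow> 'x \<Rightarrow> bool" where
  "between c x w y \<longleftrightarrow> d x w + d w y \<le> d x y + c"

lemma kappa_nonneg: "0 \<le> \<kappa>"
  using four_point[of undefined undefined undefined undefined] refl by simp

lemma between_sym: "between c x w y \<longleftrightarrow> between c y w x"
  unfolding between_def by (metis add.commute sym)

lemma between_mono: "between c x w y \<Longrightarrow> c \<le> c' \<Longrightarrow> between c' x w y"
  unfolding between_def by simp

text \<open>Thin triangles: in the four point inequality for \<open>x\<close>, \<open>y\<close> and
  \<open>w\<close>, \<open>b\<close>, the term attaining the maximum tells which of the other two
  sides \<open>w\<close> follows.\<close>

lemma between_slim:
  "between c x w y \<Longrightarrow> between (c + \<kappa>) x w b \<or> between (c + \<kappa>) b w y"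
  using four_point[of x y w b] sym[of b w] sym[of y w] sym[of y b] unfolding between_def
  by linarith

lemma between_trans:
  "between c x u y \<Longrightarrow> between c' x w u \<Longrightarrow> between (c + c') x w y"
  using triangle[of w y u] unfolding between_def by simp

lemma between_perturb:
  "between c x w y \<Longrightarrow> d w w' \<le> r \<Longrightarrow> between (c + 2 * r) x w' y"
  using triangle[of x w' w] triangle[of w' y w] sym[of w w'] unfolding between_def by simp

text \<open>In every position of the two good arguments the median lies between them. This majority
  vote later repairs tuples coordinate by coordinate.\<close>

lemma median_near:
  assumes "d x p \<le> c" "d y p \<le> c"
  shows "d (\<mu> x y z) p \<le> 2 * c + \<kappa>" "d (\<mu> x z y) p \<le> 2 * c + \<kappa>" "d (\<mu> z x y) p \<le> 2 * c + \<kappa>"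
proof -
  have near: "d w p \<le> 2 * c + \<kappa>" if "d x w + d w y \<le> d x y + \<kappa>" for w
    using that assms triangle[of w p x] triangle[of w p y] triangle[of x y p]
      sym[of x w] sym[of y p] kappa_nonneg by linarith
  show "d (\<mu> x y z) p \<le> 2 * c + \<kappa>" "d (\<mu> x z y) p \<le> 2 * c + \<kappa>" "d (\<mu> z x y) p \<le> 2 * c + \<kappa>"
    by (rule near; rule med12 med13 med23)+
qed

text \<open>If \<open>w\<close> is between \<open>u\<close> and \<open>v\<close>, two uses of
  slimness, with corners \<open>x\<close> and \<open>x'\<close>, put \<open>w\<close> between
  \<open>x\<close> and \<open>u\<close>, \<open>x\<close> and \<open>x'\<close>, or
  \<open>x'\<close> and \<open>v\<close>; the first and the last extend to intervals with both ends
  in \<open>A\<close>.\<close>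

lemma median_join_hull:
  assumes "w \<in> (median_join \<mu> ^^ k) A"
  shows "\<exists>x\<in>A. \<exists>y\<in>A. between (3 * real k * \<kappa>) x w y"
  using assms
proof (rule median_join_induct)
  fix x assume "x \<in> A"
  then show "\<exists>x'\<in>A. \<exists>y\<in>A. between (3 * real 0 * \<kappa>) x' x y"
    unfolding between_def by (intro bexI[of _ x]) (auto simp: refl)
next
  fix k w assume "\<exists>x\<in>A. \<exists>y\<in>A. between (3 * real k * \<kappa>) x w y"
  then show "\<exists>x\<in>A. \<exists>y\<in>A. between (3 * real (Suc k) * \<kappa>) x w y"
    using kappa_nonneg by (meson between_mono mult_right_mono mult_left_mono of_nat_mono le_SucI order_refl zero_le_numeral)
next
  fix k u v z
  assume "\<exists>x\<in>A. \<exists>y\<in>A. between (3 * real k * \<kappa>) x u y" "\<exists>x\<in>A. \<exists>y\<in>A. between (3 * real k * \<kappa>) x v y"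
  then obtain x y x' y' where A: "x \<in> A" "y \<in> A" "x' \<in> A" "y' \<in> A"
    and u: "between (3 * real k * \<kappa>) x u y" and v: "between (3 * real k * \<kappa>) x' v y'"
    by blast
  let ?w = "\<mu> u v z"
  have "between \<kappa> u ?w v" unfolding between_def by (rule med12)
  from between_slim[OF this, of x]
  consider "between (3 * \<kappa>) x ?w u" | "between (3 * \<kappa>) x ?w x'" | "between (3 * \<kappa>) x' ?w v"
    using between_slim[of "\<kappa> + \<kappa>" x ?w v x'] between_sym between_mono[of "\<kappa> + \<kappa>" x ?w u "3 * \<kappa>"]
      kappa_nonneg by fastforce
  then have "\<exists>p\<in>A. \<exists>q\<in>A. between (3 * real k * \<kappa> + 3 * \<kappa>) p ?w q"
  proof cases
    case 1
    then show ?thesis using between_trans[OF u] A by blast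
  next
    case 2
    then show ?thesis using between_mono[of "3 * \<kappa>" x ?w x' "3 * real k * \<kappa> + 3 * \<kappa>"] A kappa_nonneg
      by auto
  next
    case 3
    then show ?thesis using between_trans[OF v] A by blast
  qed
  then show "\<exists>p\<in>A. \<exists>q\<in>A. between (3 * real (Suc k) * \<kappa>) p ?w q"
    by (simp add: algebra_simps)
qed

text \<open>The median is between \<open>x\<close>, \<open>w\<close> and between \<open>y\<close>,
  \<open>w\<close>. On adding, its distances to \<open>x\<close> and \<open>y\<close> use up at
  least \<open>d x y\<close>, which leaves only errors for twice its distance to
  \<open>w\<close>.\<close>

lemma median_between:
  assumes "between c x w y"
  shows "d (\<mu> x y w) w \<le> c / 2 + \<kappa>" "d (\<mu> x w y) w \<le> c / 2 + \<kappa>"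
proof -
  have near: "d m w \<le> c / 2 + \<kappa>" if "d x m + d m w \<le> d x w + \<kappa>" "d y m + d m w \<le> d y w + \<kappa>" for m
    using that assms triangle[of x y m] sym[of y m] sym[of y w] unfolding between_def by linarith
  show "d (\<mu> x y w) w \<le> c / 2 + \<kappa>"
    by (rule near[OF med13 med23])
  show "d (\<mu> x w y) w \<le> c / 2 + \<kappa>"
    using med12[of x w y] med23[of w x y] sym[of w "\<mu> x w y"] sym[of y "\<mu> x w y"] sym[of y w]
    by (intro near) linarith+
qed

lemma median_join_near:
  assumes "w \<in> (median_join \<mu> ^^ k) A"
  shows "\<exists>w'\<in>median_join \<mu> A. d w' w \<le> (3 * real k + 1) * \<kappa>"
proof -
  obtain x y where A: "x \<in> A" "y \<in> A" and b: "between (3 * real k * \<kappa>) x w y"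
    using median_join_hull[OF assms] by blast
  have "d (\<mu> x y w) w \<le> (3 * real k + 1) * \<kappa>"
    using median_between(1)[OF b] mult_nonneg_nonneg[of "3 * real k" \<kappa>] kappa_nonneg
    unfolding distrib_right by linarith
  then show ?thesis using median_join_median[OF A] by blast
qed

text \<open>The slack 1 makes up for an infimum that need not be attained. The minimum is over the
  join because \<open>A\<close> is arbitrary, while its join is quasiconvex by
  \<open>median_join_near\<close>.\<close>

definition nearest :: "'x set \<Rightarrow> 'x \<Rightarrow> 'x \<Rightarrow> bool" where
  "nearest A p a \<longleftrightarrow> a \<in> median_join \<mu> A \<and> (\<forall>w\<in>median_join \<mu> A. d p a \<le> d p w + 1)"

lemma nearest_exists:
  assumes "A \<noteq> {}"
  shows "\<exists>a. nearest A p a"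
proof -
  let ?S = "d p ` median_join \<mu> A"
  have "?S \<noteq> {}" using assms unfolding median_join_def by blast
  have "bdd_below ?S" by (rule bdd_belowI2[of _ 0]) (rule nonneg)
  obtain s where "s \<in> ?S" "s < Inf ?S + 1"
    using cInf_lessD[OF \<open>?S \<noteq> {}\<close>, of "Inf ?S + 1"] by auto
  moreover have "Inf ?S \<le> d p w" if "w \<in> median_join \<mu> A" for w
    using that \<open>bdd_below ?S\<close> by (simp add: cInf_lower)
  ultimately show ?thesis unfolding nearest_def by force
qed

text \<open>The median of \<open>a\<close>, \<open>q\<close>, \<open>p\<close> belongs to a deeper
  join, hence is near the join of \<open>A\<close> and cannot be much closer to \<open>p\<close>
  than \<open>a\<close> is. Being between \<open>a\<close> and \<open>p\<close>, it is therefore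
  near \<open>a\<close>; it is also between \<open>p\<close> and \<open>q\<close>.\<close>

lemma nearest_between:
  assumes a: "nearest A p a" and q: "q \<in> (median_join \<mu> ^^ k) A"
  shows "between ((6 * real k + 17) * \<kappa> + 2) p a q"
proof -
  let ?w = "\<mu> a q p"
  have "a \<in> (median_join \<mu> ^^ Suc 0) A" using a by (simp add: nearest_def)
  then have "a \<in> (median_join \<mu> ^^ Suc k) A" "q \<in> (median_join \<mu> ^^ Suc k) A"
    using median_join_funpow_mono[of "Suc 0" "Suc k" \<mu> A] median_join_funpow_mono[of k "Suc k" \<mu> A] q
    by auto
  then have "?w \<in> (median_join \<mu> ^^ Suc (Suc k)) A"
    using median_join_median by simp
  from median_join_near[OF this] obtain w' where w': "w' \<in> median_join \<mu> A"
    and "d w' ?w \<le> (3 * real k + 7) * \<kappa>"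
    by (auto simp: algebra_simps)
  moreover have "d p a \<le> d p w' + 1" using a w' unfolding nearest_def by blast
  ultimately have "d p a \<le> d p ?w + (3 * real k + 7) * \<kappa> + 1"
    using triangle[of p w' ?w] sym[of w' ?w] by linarith
  then have "d a ?w \<le> (3 * real k + 8) * \<kappa> + 1"
    using med13[of a q p] sym[of p a] sym[of p ?w] by (simp add: algebra_simps)
  moreover have "between \<kappa> p ?w q"
    using med23[of q a p] by (subst between_sym) (simp add: between_def)
  ultimately have "between (\<kappa> + 2 * ((3 * real k + 8) * \<kappa> + 1)) p a q"
    using sym[of a ?w] by (intro between_perturb) simp_all
  then show ?thesis by (simp add: algebra_simps)
qed

text \<open>The Helly property in a hyperbolic space: among pairwise intersecting quasiconvex sets, the
  projection of a base point to the farthest set is near all of them.\<close>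

lemma nearest_farthest:
  assumes a: "nearest A p a" and b: "nearest B p b" and le: "d p b \<le> d p a + 1"
    and q: "q \<in> A" "q \<in> B"
  shows "\<exists>w\<in>(median_join \<mu> ^^ 2) B. d w a \<le> 19 * \<kappa> + 3"
proof (intro bexI)
  let ?w = "\<mu> b q a"
  have "b \<in> median_join \<mu> B" "q \<in> median_join \<mu> B"
    using b q by (auto simp: nearest_def median_join_def)
  then show "?w \<in> (median_join \<mu> ^^ 2) B"
    using median_join_median by (simp add: numeral_2_eq_2)
  have "between (17 * \<kappa> + 2) p a q" using nearest_between[OF a, of q 0] q by simp
  \<comment> \<open>Either \<open>a\<close> is on the way from \<open>p\<close> to \<open>b\<close>,
    and \<open>le\<close> forces \<open>b\<close> near \<open>a\<close>, or \<open>a\<close> is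
    between \<open>b\<close> and \<open>q\<close>, where the median of the three is near
    \<open>a\<close>.\<close>
  from between_slim[OF this, of b] show "d ?w a \<le> 19 * \<kappa> + 3"
  proof
    assume "between (17 * \<kappa> + 2 + \<kappa>) p a b"
    then show ?thesis using le med13[of b q a] nonneg[of b ?w] sym[of a b] unfolding between_def by linarith
  next
    assume "between (17 * \<kappa> + 2 + \<kappa>) b a q"
    from median_between(1)[OF this] show ?thesis using kappa_nonneg by argo
  qed
qed

text \<open>The median is between \<open>p\<close> and \<open>w\<close> and between \<open>w\<close>
  and \<open>q\<close>; as \<open>w\<close> is near \<open>a\<close>, which is between
  \<open>p\<close> and \<open>q\<close>, no room is left away from \<open>a\<close>.\<close>

lemma median_gate_near:
  assumes "between c p a q" "d w a \<le> r"
  shows "d (\<mu> p w q) a \<le> c / 2 + 2 * r + \<kappa>" "d (\<mu> p q w) a \<le> c / 2 + 2 * r + \<kappa>"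
    "d (\<mu> w q p) a \<le> c / 2 + 2 * r + \<kappa>"
proof -
  have near: "d m a \<le> c / 2 + 2 * r + \<kappa>"
    if "d p m + d m w \<le> d p w + \<kappa>" "d w m + d m q \<le> d w q + \<kappa>" for m
    using that assms triangle[of p q m] triangle[of m a w] triangle[of p w a] triangle[of w q a]
      sym[of w m] sym[of w a] unfolding between_def by linarith
  show "d (\<mu> p w q) a \<le> c / 2 + 2 * r + \<kappa>"
    by (rule near[OF med12 med23])
  show "d (\<mu> p q w) a \<le> c / 2 + 2 * r + \<kappa>"
    using near[OF med13, of q] med23[of q p w] sym[of q w] sym[of q "\<mu> p q w"] sym[of w "\<mu> p q w"]
    by linarith
  show "d (\<mu> w q p) a \<le> c / 2 + 2 * r + \<kappa>"
    using near[OF _ med12, of p] med13[of w q p] sym[of p w] sym[of p "\<mu> w q p"] sym[of w "\<mu> w q p"]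
    by linarith
qed

text \<open>A Busemann-type difference of distance functions is a coarse median map to the line.\<close>

lemma distance_difference_between:
  assumes "between c x w y"
  shows "min (d a x - d b x) (d a y - d b y) - (c + \<kappa>) \<le> d a w - d b w"
    and "d a w - d b w \<le> max (d a x - d b x) (d a y - d b y) + (c + \<kappa>)"
proof -
  have *: "min (d a x - d b x) (d a y - d b y) - (c + \<kappa>) \<le> d a w - d b w" for a b
    using between_slim[OF assms, of b] triangle[of a x w] triangle[of a y w]
      sym[of w x] sym[of w b] sym[of x b] unfolding between_def by linarith
  show "min (d a x - d b x) (d a y - d b y) - (c + \<kappa>) \<le> d a w - d b w" by (rule *)
  show "d a w - d b w \<le> max (d a x - d b x) (d a y - d b y) + (c + \<kappa>)"
    using *[of b a] by linarith
qed

end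

subsection \<open>Coordinate systems and realisation\<close>

lemma bounded_almost_max:
  fixes f :: "'b \<Rightarrow> real"
  assumes "F \<noteq> {}" "\<And>A. A \<in> F \<Longrightarrow> f A \<le> b"
  shows "\<exists>A\<in>F. \<forall>B\<in>F. f B \<le> f A + 1"
proof -
  have bdd: "bdd_above (f ` F)" using assms(2) by (rule bdd_aboveI2)
  obtain A where "A \<in> F" "Sup (f ` F) - 1 < f A"
    using less_cSupD[of "f ` F" "Sup (f ` F) - 1"] assms(1) by auto
  moreover have "f B \<le> f A + 1" if "B \<in> F" for B
    using cSup_upper[OF imageI[OF that] bdd] \<open>Sup (f ` F) - 1 < f A\<close> by simp
  ultimately show ?thesis by blast
qed

text \<open>The pair \<open>P\<close>, \<open>Q\<close> in \<open>transversality\<close> stands for the two alternatives of the consistency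
  inequality: \<open>P x\<close> says that \<open>x\<close> projects near $\rho^V_U$, and \<open>Q x\<close> that it projects near
  $\rho^U_V$.\<close>

locale coarse_median_system =
  fixes \<SS> :: "'s set"
    and D :: "'s \<Rightarrow> 'x::metric_space \<Rightarrow> 'x \<Rightarrow> real"
    and \<mu> :: "'x \<Rightarrow> 'x \<Rightarrow> 'x \<Rightarrow> 'x"
    and trv :: "'s \<Rightarrow> 's \<Rightarrow> bool"
    and \<kappa> :: real
    and N :: nat
  assumes hyp: "U \<in> \<SS> \<Longrightarrow> hyperbolic_median (D U) \<mu> \<kappa>"
    and kappa_nonneg: "0 \<le> \<kappa>"
    and lipschitz: "U \<in> \<SS> \<Longrightarrow> D U x y \<le> \<kappa> * dist x y + \<kappa>"
    and transversality: "U \<in> \<SS> \<Longrightarrow> V \<in> \<SS> \<Longrightarrow> trv U V \<Longrightarrow>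
      \<exists>P Q. (\<forall>x. P x \<or> Q x) \<and> (\<forall>x y. P x \<and> P y \<longrightarrow> D U x y \<le> \<kappa>) \<and>
        (\<forall>x y. Q x \<and> Q y \<longrightarrow> D V x y \<le> \<kappa>)"
    and antichain: "A \<subseteq> \<SS> \<Longrightarrow> finite A \<Longrightarrow> pairwise (\<lambda>U V. \<not> trv U V) A \<Longrightarrow> card A \<le> N"
    and relevant_bounded: "\<exists>n. \<forall>x y. (\<forall>W\<in>\<SS>. D W x y \<le> R) \<longrightarrow>
      finite {T\<in>\<SS>. \<kappa> \<le> D T x y} \<and> card {T\<in>\<SS>. \<kappa> \<le> D T x y} \<le> n"
    and uniqueness: "\<exists>\<theta>. \<forall>x y. (\<forall>V\<in>\<SS>. D V x y \<le> c) \<longrightarrow> dist x y \<le> \<theta>"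
begin

lemma D_sym: "U \<in> \<SS> \<Longrightarrow> D U x y = D U y x"
  using hyperbolic_median.sym[OF hyp] .

lemma D_triangle: "U \<in> \<SS> \<Longrightarrow> D U x z \<le> D U x y + D U y z"
  using hyperbolic_median.triangle[OF hyp] .

lemma D_nonneg: "U \<in> \<SS> \<Longrightarrow> 0 \<le> D U x y"
  using hyperbolic_median.nonneg[OF hyp] .

lemma D_self: "U \<in> \<SS> \<Longrightarrow> D U x x = 0"
  using hyperbolic_median.refl[OF hyp] .

lemmas median_near = hyperbolic_median.median_near[OF hyp]

text \<open>A family of points \<open>a\<close> encodes the tuple whose \<open>U\<close>-coordinate is the projection of \<open>a U\<close>.\<close>

definition pairwise_approximable :: "real \<Rightarrow> ('s \<Rightarrow> 'x) \<Rightarrow> bool" where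
  "pairwise_approximable c a \<longleftrightarrow>
     (\<exists>p R. \<forall>U\<in>\<SS>. \<forall>V\<in>\<SS>. \<exists>y. D U y (a U) \<le> c \<and> D V y (a V) \<le> c \<and> (\<forall>W\<in>\<SS>. D W p y \<le> R))"

definition controls :: "real \<Rightarrow> ('s \<Rightarrow> 'x) \<Rightarrow> 's \<Rightarrow> 's \<Rightarrow> bool" where
  "controls c a U V \<longleftrightarrow> (\<forall>x. D U x (a U) \<le> c \<longrightarrow> D V x (a V) \<le> c)"

lemma controls_trans: "controls c a U V \<Longrightarrow> controls c a V W \<Longrightarrow> controls c a U W"
  unfolding controls_def by blast

text \<open>Points near \<open>a U\<close> cannot satisfy the same alternative at \<open>U\<close>
  as \<open>p\<close>, which is far from \<open>a U\<close>. So if \<open>P p\<close>, they all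
  satisfy \<open>Q\<close>, their \<open>V\<close>-coordinates nearly agree, and \<open>y\<close>
  identifies the common value as \<open>a V\<close>. The case \<open>Q p\<close> exchanges the
  roles.\<close>

lemma controls_total:
  assumes UV: "U \<in> \<SS>" "V \<in> \<SS>" "trv U V" and c: "\<kappa> + c0 \<le> c" "0 \<le> c0"
    and y: "D U y (a U) \<le> c0" "D V y (a V) \<le> c0"
    and far: "c + \<kappa> < D U p (a U)" "c + \<kappa> < D V p (a V)"
  shows "controls c a U V \<or> controls c a V U"
proof -
  have *: "controls c a U V"
    if UV: "U \<in> \<SS>" "V \<in> \<SS>" and y: "D U y (a U) \<le> c0" "D V y (a V) \<le> c0"
      and far: "c + \<kappa> < D U p (a U)"
      and PQ: "\<And>x. P x \<or> Q x" "\<And>x y. P x \<Longrightarrow> P y \<Longrightarrow> D U x y \<le> \<kappa>" "\<And>x y. Q x \<Longrightarrow> Q y \<Longrightarrow> D V x y \<le> \<kappa>"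
      and "P p"
    for U V P Q
    unfolding controls_def
  proof (intro allI impI)
    fix x assume x: "D U x (a U) \<le> c"
    have "\<not> P w" if "D U w (a U) \<le> c" for w
    proof
      assume "P w"
      from PQ(2)[OF \<open>P p\<close> this] show False
        using that far D_triangle[OF UV(1), of p "a U" w] by linarith
    qed
    moreover have "D U y (a U) \<le> c" using y(1) c kappa_nonneg by linarith
    ultimately have "Q x" "Q y" using PQ(1) x by blast+
    then show "D V x (a V) \<le> c"
      using PQ(3)[of x y] D_triangle[OF UV(2), of x "a V" y] y c by linarith
  qed
  from transversality[OF UV] obtain P Q where "\<forall>x. P x \<or> Q x"
    "\<forall>x y. P x \<and> P y \<longrightarrow> D U x y \<le> \<kappa>" "\<forall>x y. Q x \<and> Q y \<longrightarrow> D V x y \<le> \<kappa>"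
    by (elim exE conjE)
  then have PQ: "\<And>x. P x \<or> Q x" "\<And>x y. P x \<Longrightarrow> P y \<Longrightarrow> D U x y \<le> \<kappa>"
    "\<And>x y. Q x \<Longrightarrow> Q y \<Longrightarrow> D V x y \<le> \<kappa>"
    by simp_all
  from PQ(1)[of p] show ?thesis
  proof
    assume "P p"
    from *[of U V P Q, OF UV(1,2) y far(1) PQ this] show ?thesis ..
  next
    assume "Q p"
    from *[of V U Q P, OF UV(2,1) y(2,1) far(2) _ PQ(3,2) this] show ?thesis using PQ(1) by blast
  qed
qed

text \<open>The coordinates in which \<open>p\<close> is far from the tuple are preordered by \<open>controls\<close>, and transverse
  ones are comparable. The maximal coordinates thus reduce to an antichain without transverse pairs.\<close>

lemma controlling_antichain:
  assumes a: "pairwise_approximable c0 a" and c: "\<kappa> + c0 \<le> c" "0 \<le> c0"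
  shows "\<exists>M\<subseteq>\<SS>. finite M \<and> card M \<le> N \<and>
    (\<forall>V\<in>\<SS>. c + \<kappa> < D V p (a V) \<longrightarrow> (\<exists>U\<in>M. controls c a U V))"
proof -
  define Rel where "Rel = {V\<in>\<SS>. c + \<kappa> < D V p (a V)}"
  define below where "below U = {V\<in>Rel. controls c a U V}" for U
  obtain p0 R where appr: "\<And>U V. U \<in> \<SS> \<Longrightarrow> V \<in> \<SS> \<Longrightarrow>
      \<exists>y. D U y (a U) \<le> c0 \<and> D V y (a V) \<le> c0 \<and> (\<forall>W\<in>\<SS>. D W p0 y \<le> R)"
    using a unfolding pairwise_approximable_def by blast
  obtain n where n: "\<And>x y. (\<And>W. W \<in> \<SS> \<Longrightarrow> D W x y \<le> \<kappa> * dist p p0 + \<kappa> + R) \<Longrightarrow>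
      finite {T\<in>\<SS>. \<kappa> \<le> D T x y} \<and> card {T\<in>\<SS>. \<kappa> \<le> D T x y} \<le> n"
    using relevant_bounded[of "\<kappa> * dist p p0 + \<kappa> + R"] by blast
  \<comment> \<open>The point \<open>y\<close> realises \<open>a U\<close>, hence every coordinate
    controlled by \<open>U\<close>. Where \<open>p\<close> is far from the tuple it is then far from
    \<open>y\<close>, which happens in boundedly many coordinates only. Finiteness of
    \<open>Rel\<close> is not claimed.\<close>
  have below: "finite (below U) \<and> card (below U) \<le> n" if "U \<in> Rel" for U
  proof -
    have U: "U \<in> \<SS>" using that by (simp add: Rel_def)
    obtain y where y: "D U y (a U) \<le> c0" "\<And>W. W \<in> \<SS> \<Longrightarrow> D W p0 y \<le> R" using appr[OF U U] by blast
    have "D W p y \<le> \<kappa> * dist p p0 + \<kappa> + R" if "W \<in> \<SS>" for W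
      using D_triangle[OF that, of p y p0] lipschitz[OF that, of p p0] y(2)[OF that] by linarith
    note fin = n[of p y, OF this]
    have sub: "below U \<subseteq> {T\<in>\<SS>. \<kappa> \<le> D T p y}"
    proof
      fix V assume "V \<in> below U"
      then have V: "V \<in> \<SS>" "c + \<kappa> < D V p (a V)" and "controls c a U V"
        by (simp_all add: below_def Rel_def)
      moreover have "D U y (a U) \<le> c" using y(1) c kappa_nonneg by linarith
      ultimately have "D V y (a V) \<le> c" unfolding controls_def by blast
      then have "\<kappa> \<le> D V p y" using V(2) D_triangle[OF V(1), of p "a V" y] by linarith
      then show "V \<in> {T\<in>\<SS>. \<kappa> \<le> D T p y}" using V(1) by simp
    qed
    show ?thesis
    proof
      show "finite (below U)" using sub fin by (rule finite_subset[OF _ conjunct1])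
      show "card (below U) \<le> n"
        by (rule order_trans[OF card_mono[OF conjunct1[OF fin] sub] conjunct2[OF fin]])
    qed
  qed
  define Mx where "Mx = {U\<in>Rel. \<forall>U'\<in>Rel. controls c a U' U \<longrightarrow> controls c a U U'}"
  have Mx: "\<exists>U\<in>Mx. controls c a U V" if "V \<in> Rel" for V
  proof -
    \<comment> \<open>Among the coordinates controlling \<open>V\<close>, one with the largest set
      \<open>below\<close> is maximal: whatever controls it has a \<open>below\<close> containing
      this one, hence equal to it.\<close>
    let ?P = "\<lambda>U. U \<in> Rel \<and> controls c a U V"
    have "?P V" using that by (simp add: controls_def)
    moreover have "\<forall>U. ?P U \<longrightarrow> card (below U) < Suc n" using below by (simp add: less_Suc_eq_le)
    ultimately have "\<exists>U. ?P U \<and> (\<forall>U'. ?P U' \<longrightarrow> card (below U') \<le> card (below U))"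
      by (rule ex_has_greatest_nat[where P = ?P and f = "\<lambda>U. card (below U)"])
    then obtain U where U: "?P U" and mx: "\<forall>U'. ?P U' \<longrightarrow> card (below U') \<le> card (below U)"
      by (elim exE conjE) blast
    have "controls c a U U'" if "U' \<in> Rel" "controls c a U' U" for U'
    proof -
      have "below U \<subseteq> below U'" using controls_trans[OF that(2)] unfolding below_def by blast
      moreover have "card (below U') \<le> card (below U)"
        using mx[rule_format, of U'] that(1) controls_trans[OF that(2), of V] U by simp
      ultimately have "below U = below U'" using below[OF that(1)] by (intro card_seteq) simp_all
      moreover have "U' \<in> below U'" using that(1) by (simp add: below_def controls_def)
      ultimately have "U' \<in> below U" by simp
      then show ?thesis by (simp add: below_def)
    qed
    then show ?thesis using U unfolding Mx_def by blast
  qed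
  \<comment> \<open>Maximal coordinates may control each other, so a largest set without control
    between distinct members is taken; \<open>controls_total\<close> excludes transverse pairs in
    it.\<close>
  let ?anti = "\<lambda>A. finite A \<and> A \<subseteq> Mx \<and> pairwise (\<lambda>U V. \<not> controls c a U V) A"
  have anti: "card A \<le> N" if "?anti A" for A
  proof (rule antichain)
    show "A \<subseteq> \<SS>" using that unfolding Mx_def Rel_def by blast
    show "finite A" using that by blast
    show "pairwise (\<lambda>U V. \<not> trv U V) A"
    proof (rule pairwiseI)
      fix U V assume UV: "U \<in> A" "V \<in> A" "U \<noteq> V"
      then have S: "U \<in> \<SS>" "V \<in> \<SS>" "c + \<kappa> < D U p (a U)" "c + \<kappa> < D V p (a V)"
        using that unfolding Mx_def Rel_def by auto
      obtain y where "D U y (a U) \<le> c0" "D V y (a V) \<le> c0" using appr[OF S(1,2)] by blast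
      note total = controls_total[OF S(1,2) _ c this S(3,4)]
      have "\<not> controls c a U V" "\<not> controls c a V U" using UV that unfolding pairwise_def by simp_all
      then show "\<not> trv U V" using total by blast
    qed
  qed
  have "?anti {}" by simp
  moreover have "\<forall>A. ?anti A \<longrightarrow> card A < Suc N" using anti by (simp add: less_Suc_eq_le)
  ultimately have "\<exists>M. ?anti M \<and> (\<forall>A. ?anti A \<longrightarrow> card A \<le> card M)"
    by (rule ex_has_greatest_nat[where P = ?anti and f = card])
  then obtain M where M: "?anti M" and mx: "\<forall>A. ?anti A \<longrightarrow> card A \<le> card M" by (elim exE conjE) blast
  show ?thesis
  proof (intro exI[of _ M] conjI ballI impI)
    show "M \<subseteq> \<SS>" "finite M" using M unfolding Mx_def Rel_def by blast+
    show "card M \<le> N" using M anti by blast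
    fix V assume "V \<in> \<SS>" "c + \<kappa> < D V p (a V)"
    then obtain W where W: "W \<in> Mx" "controls c a W V" using Mx unfolding Rel_def by blast
    have "\<exists>U\<in>M. controls c a U W"
    proof (rule ccontr)
      assume no: "\<not> (\<exists>U\<in>M. controls c a U W)"
      have "W \<notin> M" using no unfolding controls_def by blast
      have "\<not> controls c a W U" if "U \<in> M" for U
        using that no M W(1) unfolding Mx_def by blast
      then have "?anti (insert W M)" using M no W(1) by (auto simp: pairwise_insert)
      from mx[rule_format, OF this] show False using M \<open>W \<notin> M\<close> by simp
    qed
    then show "\<exists>U\<in>M. controls c a U V" using controls_trans[OF _ W(2)] by blast
  qed
qed

definition approx_const :: "real \<Rightarrow> nat \<Rightarrow> real" where
  "approx_const c n = ((\<lambda>t. 2 * t + \<kappa>) ^^ n) c"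

lemma approx_const_mono:
  assumes "0 \<le> c" "m \<le> n" shows "approx_const c m \<le> approx_const c n"
proof -
  have pos: "0 \<le> approx_const c k" for k
    by (induction k) (use assms(1) kappa_nonneg in \<open>auto simp: approx_const_def\<close>)
  have "approx_const c k \<le> approx_const c (Suc k)" for k
    using pos[of k] kappa_nonneg by (simp add: approx_const_def)
  then show ?thesis using assms(2) by (rule lift_Suc_mono_le)
qed

text \<open>As in a median algebra, pairwise realisability implies realisability in finitely many
  coordinates: take the median of three points each of which may fail in one coordinate.\<close>

lemma finitely_approximable:
  assumes a: "pairwise_approximable c a" and c: "0 \<le> c"
    and M: "M \<subseteq> \<SS>" "finite M" "card M \<le> n"
  shows "\<exists>x. \<forall>U\<in>M. D U x (a U) \<le> approx_const c n"
  using M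
proof (induction n arbitrary: M)
  case 0
  then show ?case by simp
next
  case (Suc n)
  have c_le: "c \<le> approx_const c (Suc n)"
    using approx_const_mono[OF c, of 0 "Suc n"] by (simp add: approx_const_def)
  show ?case
  proof (cases "card M \<le> 2")
    case True
    then have "card M = 0 \<or> card M = 1 \<or> card M = 2" by linarith
    then consider "M = {}" | U V where "M = {U, V}"
      using Suc.prems(2) by (auto simp: card_1_singleton_iff card_2_iff)
    then show ?thesis
    proof cases
      case 2
      then obtain y where "D U y (a U) \<le> c" "D V y (a V) \<le> c"
        using a Suc.prems(1) unfolding pairwise_approximable_def by blast
      then have "\<forall>W\<in>M. D W y (a W) \<le> approx_const c (Suc n)"
        using order_trans[OF _ c_le] 2 by simp
      then show ?thesis ..
    qed simp
  next
    case False
    then have "3 \<le> card M" by simp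
    then obtain T where "T \<subseteq> M" "card T = 3" by (meson obtain_subset_with_card_n)
    then obtain U1 U2 U3 where U: "U1 \<in> M" "U2 \<in> M" "U3 \<in> M" "U1 \<noteq> U2" "U1 \<noteq> U3" "U2 \<noteq> U3"
      by (auto simp: card_3_iff)
    have "\<exists>x. \<forall>V\<in>M - {U}. D V x (a V) \<le> approx_const c n" if "U \<in> M" for U
      using Suc.IH[of "M - {U}"] Suc.prems that by (simp add: subset_eq)
    then obtain x where x: "\<And>U V. U \<in> M \<Longrightarrow> V \<in> M \<Longrightarrow> V \<noteq> U \<Longrightarrow> D V (x U) (a V) \<le> approx_const c n"
      by (metis Diff_iff singletonD)
    have "D V (\<mu> (x U1) (x U2) (x U3)) (a V) \<le> approx_const c (Suc n)" if "V \<in> M" for V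
    proof -
      have "V \<in> \<SS>" using that Suc.prems by blast
      note near = median_near[OF this, of _ "a V" "approx_const c n"]
      consider "V \<noteq> U1" "V \<noteq> U2" | "V \<noteq> U1" "V \<noteq> U3" | "V \<noteq> U2" "V \<noteq> U3" using U by blast
      then show ?thesis
        by cases (use near x that U in \<open>simp add: approx_const_def\<close>)+
    qed
    then show ?thesis by blast
  qed
qed

text \<open>\<open>M1\<close> takes care of the coordinates where \<open>p\<close> fails and
  \<open>M2\<close> of those where \<open>x\<close> fails. Since \<open>x\<close> realises
  \<open>M1\<close> and \<open>y\<close> realises \<open>M1 \<union> M2\<close>, at most one of
  \<open>p\<close>, \<open>x\<close>, \<open>y\<close> is wrong in any coordinate, and their median
  is right.\<close>

theorem realisation:
  assumes "0 \<le> c0"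
  shows "\<exists>c\<ge>0. \<forall>a. pairwise_approximable c0 a \<longrightarrow> (\<exists>z. \<forall>U\<in>\<SS>. D U z (a U) \<le> c)"
proof -
  define c where "c = max (\<kappa> + c0) (approx_const c0 (2 * N))"
  have c: "\<kappa> + c0 \<le> c" "approx_const c0 N \<le> c" "approx_const c0 (2 * N) \<le> c"
    using approx_const_mono[OF assms, of N "2 * N"] by (auto simp: c_def)
  have "\<exists>z. \<forall>U\<in>\<SS>. D U z (a U) \<le> 2 * (c + \<kappa>) + \<kappa>" if a: "pairwise_approximable c0 a" for a
  proof -
    fix p :: 'x
    obtain M1 where M1: "M1 \<subseteq> \<SS>" "finite M1" "card M1 \<le> N"
      "\<forall>V\<in>\<SS>. c + \<kappa> < D V p (a V) \<longrightarrow> (\<exists>U\<in>M1. controls c a U V)"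
      using controlling_antichain[OF a c(1) assms, where p = p] by (elim exE conjE)
    obtain x where "\<forall>U\<in>M1. D U x (a U) \<le> approx_const c0 N"
      using finitely_approximable[OF a assms M1(1,2,3)] by blast
    then have x: "D U x (a U) \<le> c" if "U \<in> M1" for U
      using that c(2) by force
    obtain M2 where M2: "M2 \<subseteq> \<SS>" "finite M2" "card M2 \<le> N"
      "\<forall>V\<in>\<SS>. c + \<kappa> < D V x (a V) \<longrightarrow> (\<exists>U\<in>M2. controls c a U V)"
      using controlling_antichain[OF a c(1) assms, where p = x] by (elim exE conjE)
    have "card (M1 \<union> M2) \<le> 2 * N" using card_Un_le[of M1 M2] M1(3) M2(3) by linarith
    then obtain y where "\<forall>U\<in>M1 \<union> M2. D U y (a U) \<le> approx_const c0 (2 * N)"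
      using finitely_approximable[OF a assms, of "M1 \<union> M2" "2 * N"] M1(1,2) M2(1,2) by blast
    then have y: "D U y (a U) \<le> c" if "U \<in> M1 \<union> M2" for U
      using that c(3) by force
    have "D V (\<mu> p x y) (a V) \<le> 2 * (c + \<kappa>) + \<kappa>" if V: "V \<in> \<SS>" for V
    proof -
      have xy: "D V x (a V) \<le> c \<and> D V y (a V) \<le> c" if "c + \<kappa> < D V p (a V)"
        using M1(4)[rule_format, OF V that] x y unfolding controls_def by blast
      have y': "D V y (a V) \<le> c" if "c + \<kappa> < D V x (a V)"
        using M2(4)[rule_format, OF V that] y unfolding controls_def by blast
      note near = median_near[OF V, of _ "a V" "c + \<kappa>"]
      consider "D V p (a V) \<le> c + \<kappa>" "D V x (a V) \<le> c + \<kappa>"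
        | "D V p (a V) \<le> c + \<kappa>" "D V y (a V) \<le> c + \<kappa>" | "D V x (a V) \<le> c + \<kappa>" "D V y (a V) \<le> c + \<kappa>"
        using xy y' kappa_nonneg by linarith
      then show ?thesis by cases (rule near; assumption)+
    qed
    then show ?thesis by blast
  qed
  moreover have "0 \<le> 2 * (c + \<kappa>) + \<kappa>" using c(1) assms kappa_nonneg by simp
  ultimately show ?thesis by blast
qed

subsection \<open>Points near a median quasiconvex set\<close>

text \<open>A median with last argument \<open>z\<close> is between \<open>z\<close> and each other
  argument, so in every coordinate it is as close to \<open>z\<close> as the better of the two, up
  to \<open>\<kappa>\<close>.\<close>

lemma iterated_gate:
  assumes "finite M" "q0 \<in> A" "\<forall>U\<in>M. q U \<in> A"
  shows "\<exists>g\<in>(median_join \<mu> ^^ card M) A. \<forall>V\<in>\<SS>. \<forall>c. D V q0 z \<le> c \<or> (\<exists>U\<in>M. D V (q U) z \<le> c) \<longrightarrow>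
    D V g z \<le> c + card M * \<kappa>"
  using assms(1,3)
proof (induction M rule: finite_induct)
  case empty
  then show ?case using assms(2) by auto
next
  case (insert U M)
  have "\<forall>W\<in>M. q W \<in> A" using insert.prems by blast
  from insert.IH[OF this] obtain g where g: "g \<in> (median_join \<mu> ^^ card M) A"
    and near: "\<forall>V\<in>\<SS>. \<forall>c. D V q0 z \<le> c \<or> (\<exists>U\<in>M. D V (q U) z \<le> c) \<longrightarrow> D V g z \<le> c + card M * \<kappa>"
    by (elim bexE)
  have "q U \<in> (median_join \<mu> ^^ card M) A"
    using median_join_funpow_mono[of 0 "card M" \<mu> A] insert.prems by auto
  then have mem: "\<mu> g (q U) z \<in> (median_join \<mu> ^^ card (insert U M)) A"
    using g insert.hyps median_join_median by simp
  have "D V (\<mu> g (q U) z) z \<le> c + card (insert U M) * \<kappa>"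
    if V: "V \<in> \<SS>" and c: "D V q0 z \<le> c \<or> (\<exists>W\<in>insert U M. D V (q W) z \<le> c)" for V c
  proof -
    have "D V (\<mu> g (q U) z) z \<le> D V g z + \<kappa>" "D V (\<mu> g (q U) z) z \<le> D V (q U) z + \<kappa>"
      using hyperbolic_median.med13[OF hyp[OF V], of g "q U" z]
        hyperbolic_median.med23[OF hyp[OF V], of "q U" g z]
        D_nonneg[OF V, of g "\<mu> g (q U) z"] D_nonneg[OF V, of "q U" "\<mu> g (q U) z"] by linarith+
    moreover have "D V g z \<le> c + card M * \<kappa> \<or> D V (q U) z \<le> c" using c near[rule_format, OF V, of c] by blast
    moreover have "0 \<le> card M * \<kappa>" using kappa_nonneg by simp
    ultimately show ?thesis using insert.hyps by (simp add: algebra_simps) linarith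
  qed
  then show ?case using mem by blast
qed

text \<open>A coarse Caratheodory theorem: the number of points of \<open>A\<close> entering the iterated median is bounded.\<close>

theorem near_median_join:
  assumes c0: "0 \<le> c0"
  shows "\<exists>\<theta>. \<forall>A z. A \<noteq> {} \<and> (\<forall>U\<in>\<SS>. \<exists>w\<in>A. D U w z \<le> c0) \<longrightarrow>
    (\<exists>g\<in>(median_join \<mu> ^^ N) A. dist z g \<le> \<theta>)"
proof -
  let ?c = "\<kappa> + c0"
  obtain \<theta> where \<theta>: "\<And>x y. (\<And>V. V \<in> \<SS> \<Longrightarrow> D V x y \<le> ?c + \<kappa> + N * \<kappa>) \<Longrightarrow> dist x y \<le> \<theta>"
    using uniqueness[of "?c + \<kappa> + N * \<kappa>"] by blast
  show ?thesis
  proof (intro exI[of _ \<theta>] allI impI, elim conjE)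
    fix A z assume "A \<noteq> {}" and near: "\<forall>U\<in>\<SS>. \<exists>w\<in>A. D U w z \<le> c0"
    obtain q0 where q0: "q0 \<in> A" using \<open>A \<noteq> {}\<close> by blast
    \<comment> \<open>For the constant tuple at \<open>z\<close>, control means that nearness to
      \<open>z\<close> propagates. So, besides \<open>q0\<close>, only the points chosen for the
      coordinates in \<open>M\<close> are needed.\<close>
    have const: "pairwise_approximable c0 (\<lambda>U. z)"
      unfolding pairwise_approximable_def
      by (rule exI[of _ z], rule exI[of _ 0]) (auto intro!: exI[of _ z] simp: D_self c0)
    obtain M where M: "M \<subseteq> \<SS>" "finite M" "card M \<le> N"
      "\<forall>V\<in>\<SS>. ?c + \<kappa> < D V q0 z \<longrightarrow> (\<exists>U\<in>M. controls ?c (\<lambda>U. z) U V)"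
      using controlling_antichain[OF const order_refl c0, where p = q0] by (elim exE conjE)
    obtain q where q: "\<And>U. U \<in> \<SS> \<Longrightarrow> q U \<in> A \<and> D U (q U) z \<le> c0" using near by metis
    have "\<forall>U\<in>M. q U \<in> A" using q M(1) by blast
    from iterated_gate[OF M(2) q0 this, of z] obtain g where g: "g \<in> (median_join \<mu> ^^ card M) A"
      and gz: "\<forall>V\<in>\<SS>. \<forall>c. D V q0 z \<le> c \<or> (\<exists>U\<in>M. D V (q U) z \<le> c) \<longrightarrow> D V g z \<le> c + card M * \<kappa>"
      by (elim bexE)
    have "D V z g \<le> ?c + \<kappa> + N * \<kappa>" if V: "V \<in> \<SS>" for V
    proof -
      have "\<exists>U\<in>M. D V (q U) z \<le> ?c" if "?c + \<kappa> < D V q0 z"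
      proof -
        from M(4)[rule_format, OF V that] obtain U where "U \<in> M" "controls ?c (\<lambda>U. z) U V" by blast
        moreover have "D U (q U) z \<le> ?c" using q[of U] \<open>U \<in> M\<close> M(1) kappa_nonneg by force
        ultimately show ?thesis unfolding controls_def by blast
      qed
      then have "D V g z \<le> ?c + \<kappa> + card M * \<kappa>"
        using gz[rule_format, OF V, of "?c + \<kappa>"] kappa_nonneg by force
      moreover have "card M * \<kappa> \<le> N * \<kappa>" using M(3) kappa_nonneg by (simp add: mult_right_mono)
      ultimately show ?thesis using D_sym[OF V, of z g] by linarith
    qed
    then have "dist z g \<le> \<theta>" by (rule \<theta>)
    then show "\<exists>g\<in>(median_join \<mu> ^^ N) A. dist z g \<le> \<theta>"
      using subsetD[OF median_join_funpow_mono[OF M(3)] g] by blast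
  qed
qed

subsection \<open>The coarse Helly property\<close>

text \<open>\<open>R\<close> only makes suprema exist and sets of coordinates finite; no constant
  depends on it. The second conclusion, betweenness with respect to a whole member of
  \<open>F\<close>, provides gates.\<close>

theorem coarse_helly:
  shows "\<exists>c \<theta> n. \<forall>F p R. F \<noteq> {} \<and> (\<forall>A\<in>F. \<forall>B\<in>F. \<exists>q\<in>A \<inter> B. \<forall>W\<in>\<SS>. D W p q \<le> R) \<longrightarrow>
    (\<exists>z. (\<forall>A\<in>F. \<exists>q\<in>(median_join \<mu> ^^ n) A. dist z q \<le> \<theta>) \<and>
         (\<forall>U\<in>\<SS>. \<exists>A\<in>F. \<forall>x\<in>A. D U p z + D U z x \<le> D U p x + c))"
proof -
  \<comment> \<open>\<open>?b\<close> comes from \<open>nearest_farthest\<close>, \<open>?c\<close>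
    is the error of \<open>nearest_between\<close> for three joins, and \<open>c0\<close> results
    from two uses of \<open>median_gate_near\<close>.\<close>
  let ?b = "19 * \<kappa> + 3" and ?c = "35 * \<kappa> + 2"
  define c0 where "c0 = ?c / 2 + 2 * (?c / 2 + 2 * ?b + \<kappa>) + \<kappa>"
  have "0 \<le> c0" using kappa_nonneg by (simp add: c0_def)
  from realisation[OF this] obtain c1 where "0 \<le> c1"
    and real: "\<forall>a. pairwise_approximable c0 a \<longrightarrow> (\<exists>z. \<forall>U\<in>\<SS>. D U z (a U) \<le> c1)"
    by (elim exE conjE)
  have "0 \<le> ?b + c1" using kappa_nonneg \<open>0 \<le> c1\<close> by simp
  from near_median_join[OF this] obtain \<theta> where near: "\<forall>A z. A \<noteq> {} \<and>
      (\<forall>U\<in>\<SS>. \<exists>w\<in>A. D U w z \<le> ?b + c1) \<longrightarrow> (\<exists>g\<in>(median_join \<mu> ^^ N) A. dist z g \<le> \<theta>)"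
    by (elim exE)
  show ?thesis
  proof (rule exI[of _ "17 * \<kappa> + 2 + 2 * c1"], rule exI[of _ \<theta>], rule exI[of _ "N + 2"],
      intro allI impI, elim conjE)
    fix F p R
    assume "F \<noteq> {}" and "\<forall>A\<in>F. \<forall>B\<in>F. \<exists>q\<in>A \<inter> B. \<forall>W\<in>\<SS>. D W p q \<le> R"
    then have F: "\<exists>q\<in>A \<inter> B. \<forall>W\<in>\<SS>. D W p q \<le> R" if "A \<in> F" "B \<in> F" for A B
      using that by simp
    have gate: "\<exists>A b. A \<in> F \<and> hyperbolic_median.nearest (D U) \<mu> A p b \<and>
        (\<forall>B\<in>F. \<exists>w\<in>(median_join \<mu> ^^ 2) B. D U w b \<le> ?b)" if U: "U \<in> \<SS>" for U
    proof -
      interpret hyperbolic_median "D U" \<mu> \<kappa> by (rule hyp[OF U])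
      have "\<exists>b. nearest A p b" if "A \<in> F" for A using nearest_exists F[OF that that] by blast
      then obtain b where b: "\<And>A. A \<in> F \<Longrightarrow> nearest A p (b A)" by metis
      have "D U p (b A) \<le> R + 1" if A: "A \<in> F" for A
      proof -
        obtain q where "q \<in> A" "D U p q \<le> R" using F[OF A A] U by blast
        then show ?thesis using b[OF A] unfolding nearest_def median_join_def by force
      qed
      from bounded_almost_max[OF \<open>F \<noteq> {}\<close> this] obtain A where A: "A \<in> F"
        and mx: "\<And>B. B \<in> F \<Longrightarrow> D U p (b B) \<le> D U p (b A) + 1" by metis
      have "\<exists>w\<in>(median_join \<mu> ^^ 2) B. D U w (b A) \<le> ?b" if B: "B \<in> F" for B
        using nearest_farthest[OF b[OF A] b[OF B] mx[OF B]] F[OF A B] by blast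
      then show ?thesis using A b by blast
    qed
    then obtain X a where X: "\<And>U. U \<in> \<SS> \<Longrightarrow> X U \<in> F"
      and a: "\<And>U. U \<in> \<SS> \<Longrightarrow> hyperbolic_median.nearest (D U) \<mu> (X U) p (a U)"
      and helly: "\<And>U B. U \<in> \<SS> \<Longrightarrow> B \<in> F \<Longrightarrow> \<exists>w\<in>(median_join \<mu> ^^ 2) B. D U w (a U) \<le> ?b"
      by metis
    have between: "D U p (a U) + D U (a U) q \<le> D U p q + ((6 * real k + 17) * \<kappa> + 2)"
      if "U \<in> \<SS>" "q \<in> (median_join \<mu> ^^ k) (X U)" for U q k
      using hyperbolic_median.nearest_between[OF hyp[OF that(1)] a[OF that(1)] that(2)]
      unfolding hyperbolic_median.between_def[OF hyp[OF that(1)]] .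
    have between3: "hyperbolic_median.between (D U) ?c p (a U) q"
      if "U \<in> \<SS>" "q \<in> (median_join \<mu> ^^ k) (X U)" "k \<le> 3" for U q k
    proof -
      have "q \<in> (median_join \<mu> ^^ 3) (X U)" by (rule subsetD[OF median_join_funpow_mono[OF that(3)] that(2)])
      from between[OF that(1) this] show ?thesis
        unfolding hyperbolic_median.between_def[OF hyp[OF that(1)]] by simp
    qed
    have "pairwise_approximable c0 a"
      unfolding pairwise_approximable_def
    proof (rule exI[of _ p], rule exI[of _ "R + 2 * \<kappa>"], intro ballI)
      fix U V assume UV: "U \<in> \<SS>" "V \<in> \<SS>"
      obtain q where q: "q \<in> X U" "q \<in> X V" "\<And>W. W \<in> \<SS> \<Longrightarrow> D W p q \<le> R"
        using F[OF X[OF UV(1)] X[OF UV(2)]] by blast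
      obtain u where u: "u \<in> (median_join \<mu> ^^ 2) (X V)" "D U u (a U) \<le> ?b"
        using helly[OF UV(1) X[OF UV(2)]] by blast
      obtain v where v: "v \<in> (median_join \<mu> ^^ 2) (X U)" "D V v (a V) \<le> ?b"
        using helly[OF UV(2) X[OF UV(1)]] by blast
      \<comment> \<open>\<open>u\<close> has the right \<open>U\<close>-coordinate but may be far
        from \<open>p\<close>. The median with \<open>q\<close> and \<open>p\<close> keeps that
        coordinate, stays in a join of \<open>X V\<close> and is bounded in terms of
        \<open>q\<close>. The median of \<open>p\<close>, \<open>?x\<close>, \<open>?y\<close> is
        right in both coordinates, as \<open>a U\<close> is between \<open>p\<close> and
        \<open>?y\<close>, and \<open>a V\<close> between \<open>p\<close> and
        \<open>?x\<close>.\<close>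
      let ?x = "\<mu> u q p" and ?y = "\<mu> v q p"
      have "q \<in> (median_join \<mu> ^^ 2) (X U)" "q \<in> (median_join \<mu> ^^ 2) (X V)"
        using q median_join_funpow_mono[of 0 2] by force+
      then have mem: "?x \<in> (median_join \<mu> ^^ 3) (X V)" "?y \<in> (median_join \<mu> ^^ 3) (X U)"
        using u v median_join_median by (simp_all add: numeral_3_eq_3 numeral_2_eq_2)
      have q0: "q \<in> (median_join \<mu> ^^ 0) (X U)" "q \<in> (median_join \<mu> ^^ 0) (X V)" using q by simp_all
      have x: "D U ?x (a U) \<le> ?c / 2 + 2 * ?b + \<kappa>"
        by (rule hyperbolic_median.median_gate_near(3)[OF hyp[OF UV(1)] between3[OF UV(1) q0(1) le0] u(2)])
      have y: "D V ?y (a V) \<le> ?c / 2 + 2 * ?b + \<kappa>"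
        by (rule hyperbolic_median.median_gate_near(3)[OF hyp[OF UV(2)] between3[OF UV(2) q0(2) le0] v(2)])
      have "D U (\<mu> p ?x ?y) (a U) \<le> c0" unfolding c0_def
        by (rule hyperbolic_median.median_gate_near(1)[OF hyp[OF UV(1)] between3[OF UV(1) mem(2) order_refl] x])
      moreover have "D V (\<mu> p ?x ?y) (a V) \<le> c0" unfolding c0_def
        by (rule hyperbolic_median.median_gate_near(2)[OF hyp[OF UV(2)] between3[OF UV(2) mem(1) order_refl] y])
      moreover have "D W p (\<mu> p ?x ?y) \<le> R + 2 * \<kappa>" if W: "W \<in> \<SS>" for W
        using hyperbolic_median.med12[OF hyp[OF W], of p ?x ?y] D_nonneg[OF W, of "\<mu> p ?x ?y" ?x]
          hyperbolic_median.med23[OF hyp[OF W], of q u p] D_nonneg[OF W, of q ?x]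
          D_sym[OF W, of p ?x] D_sym[OF W, of p q] q(3)[OF W] by linarith
      ultimately show "\<exists>y. D U y (a U) \<le> c0 \<and> D V y (a V) \<le> c0 \<and> (\<forall>W\<in>\<SS>. D W p y \<le> R + 2 * \<kappa>)"
        by blast
    qed
    from real[rule_format, OF this] obtain z where z: "\<And>U. U \<in> \<SS> \<Longrightarrow> D U z (a U) \<le> c1" by blast
    have "\<exists>q\<in>(median_join \<mu> ^^ (N + 2)) A. dist z q \<le> \<theta>" if A: "A \<in> F" for A
    proof -
      have "\<forall>U\<in>\<SS>. \<exists>w\<in>(median_join \<mu> ^^ 2) A. D U w z \<le> ?b + c1"
      proof
        fix U assume U: "U \<in> \<SS>"
        obtain w where w: "w \<in> (median_join \<mu> ^^ 2) A" "D U w (a U) \<le> ?b" using helly[OF U A] by blast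
        then have "D U w z \<le> ?b + c1"
          using z[OF U] D_triangle[OF U, of w z "a U"] D_sym[OF U, of z "a U"] by linarith
        then show "\<exists>w\<in>(median_join \<mu> ^^ 2) A. D U w z \<le> ?b + c1" using w(1) by blast
      qed
      moreover have "(median_join \<mu> ^^ 2) A \<noteq> {}"
        using F[OF A A] median_join_funpow_mono[of 0 2 \<mu> A] by auto
      ultimately have "\<exists>g\<in>(median_join \<mu> ^^ N) ((median_join \<mu> ^^ 2) A). dist z g \<le> \<theta>"
        using near by blast
      then show ?thesis by (simp only: funpow_add comp_apply)
    qed
    moreover have "\<exists>A\<in>F. \<forall>x\<in>A. D U p z + D U z x \<le> D U p x + (17 * \<kappa> + 2 + 2 * c1)" if U: "U \<in> \<SS>" for U
    proof (intro bexI[OF _ X[OF U]] ballI)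
      fix x assume "x \<in> X U"
      then show "D U p z + D U z x \<le> D U p x + (17 * \<kappa> + 2 + 2 * c1)"
        using between[OF U, of x 0] D_triangle[OF U, of p z "a U"] D_triangle[OF U, of z x "a U"]
          D_sym[OF U, of z "a U"] z[OF U] by simp
    qed
    ultimately show "\<exists>z. (\<forall>A\<in>F. \<exists>q\<in>(median_join \<mu> ^^ (N + 2)) A. dist z q \<le> \<theta>) \<and>
      (\<forall>U\<in>\<SS>. \<exists>A\<in>F. \<forall>x\<in>A. D U p z + D U z x \<le> D U p x + (17 * \<kappa> + 2 + 2 * c1))"
      by blast
  qed
qed

end

subsection \<open>Contractions and the metric they define\<close>

lemma real_median_le_max:
  "real_median a b c \<le> max a b" "real_median a b c \<le> max b c" "real_median a b c \<le> max a c"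
  unfolding real_median_def by auto

lemma real_median_near:
  assumes "min a b - e \<le> m" "min b c - e \<le> m" "min a c - e \<le> m"
    and "m \<le> max a b + e" "m \<le> max b c + e" "m \<le> max a c + e"
  shows "\<bar>m - real_median a b c\<bar> \<le> e"
  using assms unfolding real_median_def by (auto simp: max_def min_def split: if_splits)

lemma real_median_mono_comp:
  fixes f :: "real \<Rightarrow> real"
  assumes "mono f"
  shows "real_median (f a) (f b) (f c) = f (real_median a b c)"
  unfolding real_median_def using assms by (simp add: max_of_mono min_of_mono)

lemma K_contraction_comp:
  fixes f :: "real \<Rightarrow> real"
  assumes "K_contraction K \<mu> \<Phi>" "mono f" "\<And>s t. \<bar>f s - f t\<bar> \<le> \<bar>s - t\<bar>"
  shows "K_contraction K \<mu> (\<lambda>x. f (\<Phi> x))"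
  using assms unfolding K_contraction_def real_median_mono_comp[OF assms(2)] by (meson order_trans)

lemma K_contraction_uminus:
  assumes "K_contraction K \<mu> \<Phi>"
  shows "K_contraction K \<mu> (\<lambda>x. - \<Phi> x)"
proof -
  have "real_median (- a) (- b) (- c) = - real_median a b c" for a b c :: real
    unfolding real_median_def by (auto simp: max_def min_def)
  then show ?thesis using assms unfolding K_contraction_def by (simp add: abs_minus_commute)
qed

lemma K_contraction_shift:
  "K_contraction K \<mu> \<Phi> \<Longrightarrow> K_contraction K \<mu> (\<lambda>x. \<Phi> x - c)"
  by (rule K_contraction_comp[where f = "\<lambda>t. t - c"]) (auto simp: mono_def)

lemma K_contraction_const: "K \<ge> 0 \<Longrightarrow> K_contraction K \<mu> (\<lambda>x. c)"
  unfolding K_contraction_def real_median_def by simp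

text \<open>The additive error absorbs any oscillation of size \<open>K\<close>. This is what makes
  \<open>\<sigma>\<close> separate points.\<close>

lemma K_contraction_bounded:
  assumes "\<And>x. 0 \<le> \<Phi> x" "\<And>x. \<Phi> x \<le> K"
  shows "K_contraction K \<mu> \<Phi>"
proof -
  have "0 \<le> real_median (\<Phi> x) (\<Phi> y) (\<Phi> z)" for x y z
    unfolding real_median_def using assms(1) by (simp add: le_max_iff_disj)
  moreover have "real_median (\<Phi> x) (\<Phi> y) (\<Phi> z) \<le> K" for x y z
    using real_median_le_max(1)[of "\<Phi> x" "\<Phi> y" "\<Phi> z"] assms(2)[of x] assms(2)[of y] by linarith
  ultimately have "\<bar>\<Phi> (\<mu> x y z) - real_median (\<Phi> x) (\<Phi> y) (\<Phi> z)\<bar> \<le> K" for x y z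
    using assms[of "\<mu> x y z"] by (smt (verit))
  moreover have "\<bar>\<Phi> x - \<Phi> y\<bar> \<le> dist x y + K" for x y
    using assms[of x] assms[of y] zero_le_dist[of x y] by linarith
  ultimately show ?thesis unfolding K_contraction_def by blast
qed

lemma K_contraction_dist: "K_contraction K \<mu> \<Phi> \<Longrightarrow> \<bar>\<Phi> x - \<Phi> y\<bar> \<le> dist x y + K"
  unfolding K_contraction_def by blast

lemma K_contraction_median:
  "K_contraction K \<mu> \<Phi> \<Longrightarrow> \<bar>\<Phi> (\<mu> x y z) - real_median (\<Phi> x) (\<Phi> y) (\<Phi> z)\<bar> \<le> K"
  unfolding K_contraction_def by blast

locale contractions =
  fixes \<mu> :: "'x::metric_space \<Rightarrow> 'x \<Rightarrow> 'x \<Rightarrow> 'x" and K :: real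
  assumes K_pos: "0 < K"
begin

abbreviation \<sigma> :: "'x \<Rightarrow> 'x \<Rightarrow> real" where
  "\<sigma> \<equiv> contraction_metric K \<mu>"

abbreviation contr :: "('x \<Rightarrow> real) \<Rightarrow> bool" where
  "contr \<equiv> K_contraction K \<mu>"

definition attained :: "'x \<Rightarrow> 'x \<Rightarrow> real set" where
  "attained a b = {r. r \<ge> 0 \<and> (\<exists>\<Phi>. contr \<Phi> \<and> \<Phi> a = 0 \<and> \<Phi> b = r)}"

lemma sigma_eq: "\<sigma> a b = Sup (attained a b)"
  unfolding contraction_metric_def attained_def ..

lemma attained_bound: "r \<in> attained a b \<Longrightarrow> r \<le> dist a b + K"
  unfolding attained_def using K_contraction_dist[of K \<mu> _ a b] by force

lemma bdd_attained: "bdd_above (attained a b)"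
  using attained_bound by (rule bdd_aboveI)

lemma zero_attained: "0 \<in> attained a b"
  unfolding attained_def using K_contraction_const[of K \<mu> 0] K_pos by auto

lemma sigma_nonneg: "0 \<le> \<sigma> a b"
  unfolding sigma_eq using zero_attained bdd_attained by (rule cSup_upper)

lemma contr_le_sigma:
  assumes "contr \<Phi>"
  shows "\<Phi> b - \<Phi> a \<le> \<sigma> a b"
proof (cases "\<Phi> b - \<Phi> a \<ge> 0")
  case True
  then have "\<Phi> b - \<Phi> a \<in> attained a b"
    unfolding attained_def using K_contraction_shift[OF assms, of "\<Phi> a"] by auto
  then show ?thesis unfolding sigma_eq using bdd_attained by (rule cSup_upper)
next
  case False
  then show ?thesis using sigma_nonneg[of a b] by simp
qed

lemma sigma_leI:
  assumes "\<And>\<Phi>. contr \<Phi> \<Longrightarrow> \<Phi> a = 0 \<Longrightarrow> 0 \<le> \<Phi> b \<Longrightarrow> \<Phi> b \<le> r"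
  shows "\<sigma> a b \<le> r"
  unfolding sigma_eq
proof (rule cSup_least)
  show "attained a b \<noteq> {}" using zero_attained by blast
  show "t \<le> r" if "t \<in> attained a b" for t using that assms unfolding attained_def by blast
qed

lemma sigma_greater:
  assumes "r < \<sigma> a b"
  shows "\<exists>\<Phi>. contr \<Phi> \<and> \<Phi> a = 0 \<and> r < \<Phi> b"
proof -
  have "attained a b \<noteq> {}" using zero_attained by blast
  from less_cSupD[OF this] assms obtain s where "s \<in> attained a b" "r < s" unfolding sigma_eq by blast
  then show ?thesis unfolding attained_def by blast
qed

lemma sigma_le_dist: "\<sigma> a b \<le> dist a b + K"
proof (rule sigma_leI)
  fix \<Phi> assume "contr \<Phi>" "\<Phi> a = 0"
  then show "\<Phi> b \<le> dist a b + K" using K_contraction_dist[of K \<mu> \<Phi> a b] by simp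
qed

lemma sigma_triangle: "\<sigma> a c \<le> \<sigma> a b + \<sigma> b c"
proof (rule sigma_leI)
  fix \<Phi> assume "contr \<Phi>" "\<Phi> a = 0"
  then show "\<Phi> c \<le> \<sigma> a b + \<sigma> b c"
    using contr_le_sigma[of \<Phi> b a] contr_le_sigma[of \<Phi> c b] by simp
qed

lemma sigma_sym: "\<sigma> a b = \<sigma> b a"
proof -
  have "\<sigma> a b \<le> \<sigma> b a" for a b
  proof (rule sigma_leI)
    fix \<Phi> assume "contr \<Phi>" "\<Phi> a = 0"
    then show "\<Phi> b \<le> \<sigma> b a"
      using contr_le_sigma[OF K_contraction_uminus, of \<Phi> a b] by simp
  qed
  then show ?thesis by (simp add: order_antisym)
qed

lemma sigma_self: "\<sigma> a a = 0"
  using sigma_leI[of a a 0] sigma_nonneg[of a a] by fastforce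

lemma sigma_pos:
  assumes "a \<noteq> b"
  shows "0 < \<sigma> a b"
proof -
  have "contr (\<lambda>x. if x = b then K else 0)"
    using K_pos by (intro K_contraction_bounded) auto
  from contr_le_sigma[OF this, of b a] show ?thesis using assms K_pos by simp
qed

lemma Metric_space_sigma: "Metric_space UNIV \<sigma>"
proof
  show "\<sigma> x y = 0 \<longleftrightarrow> x = y" for x y using sigma_pos[of x y] sigma_self by force
qed (rule sigma_nonneg sigma_sym sigma_triangle)+

lemma sigma_median:
  "\<sigma> a (\<mu> x y z) \<le> max (\<sigma> a x) (\<sigma> a y) + K"
  "\<sigma> a (\<mu> x y z) \<le> max (\<sigma> a y) (\<sigma> a z) + K"
  "\<sigma> a (\<mu> x y z) \<le> max (\<sigma> a x) (\<sigma> a z) + K"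
proof -
  have "\<Phi> (\<mu> x y z) \<le> max (\<sigma> a x) (\<sigma> a y) + K \<and> \<Phi> (\<mu> x y z) \<le> max (\<sigma> a y) (\<sigma> a z) + K \<and>
      \<Phi> (\<mu> x y z) \<le> max (\<sigma> a x) (\<sigma> a z) + K" if "contr \<Phi>" "\<Phi> a = 0" for \<Phi>
    using contr_le_sigma[OF that(1), of x a] contr_le_sigma[OF that(1), of y a]
      contr_le_sigma[OF that(1), of z a] K_contraction_median[OF that(1), of x y z] that(2)
      real_median_le_max[of "\<Phi> x" "\<Phi> y" "\<Phi> z"] by linarith
  then show "\<sigma> a (\<mu> x y z) \<le> max (\<sigma> a x) (\<sigma> a y) + K"
    "\<sigma> a (\<mu> x y z) \<le> max (\<sigma> a y) (\<sigma> a z) + K"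
    "\<sigma> a (\<mu> x y z) \<le> max (\<sigma> a x) (\<sigma> a z) + K"
    by (simp_all add: sigma_leI)
qed

lemma sigma_ball_join:
  assumes "q \<in> (median_join \<mu> ^^ n) {x. \<sigma> a x \<le> r}"
  shows "\<sigma> a q \<le> r + n * K"
  using assms
proof (rule median_join_induct)
  fix k x y z assume "\<sigma> a x \<le> r + real k * K" "\<sigma> a y \<le> r + real k * K"
  then show "\<sigma> a (\<mu> x y z) \<le> r + real (Suc k) * K"
    using sigma_median(1)[of a x y z] by (simp add: algebra_simps)
qed (use K_pos in \<open>auto simp: algebra_simps\<close>)

lemma superlevel_join:
  assumes "contr \<Phi>" and "q \<in> (median_join \<mu> ^^ n) {x. t \<le> \<Phi> x}"
  shows "t - n * K \<le> \<Phi> q"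
  using assms(2)
proof (rule median_join_induct)
  fix k x y z assume "t - real k * K \<le> \<Phi> x" "t - real k * K \<le> \<Phi> y"
  moreover have "min (\<Phi> x) (\<Phi> y) \<le> real_median (\<Phi> x) (\<Phi> y) (\<Phi> z)" unfolding real_median_def by simp
  ultimately have "t - real k * K - K \<le> \<Phi> (\<mu> x y z)"
    using K_contraction_median[OF assms(1), of x y z] by linarith
  then show "t - real (Suc k) * K \<le> \<Phi> (\<mu> x y z)" by (simp add: algebra_simps)
qed (use K_pos in \<open>auto simp: algebra_simps\<close>)

end

subsection \<open>Gluing contractions\<close>

text \<open>\<open>\<Phi>\<close> need not be continuous, so the intermediate value theorem is
  replaced by the first point of a subdivision of mesh at most 1 that reaches level
  \<open>t\<close>; it overshoots by at most \<open>K + 1\<close>.\<close>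

lemma geodesic_crossing:
  fixes \<Phi> :: "'x::metric_space \<Rightarrow> real"
  assumes geod: "geodesic_space (UNIV :: 'x set) dist"
    and \<Phi>: "\<And>x y. \<bar>\<Phi> x - \<Phi> y\<bar> \<le> dist x y + K"
    and y: "\<Phi> y < t" and x: "t \<le> \<Phi> x"
  shows "\<exists>w. dist y w + dist w x = dist y x \<and> t \<le> \<Phi> w \<and> \<Phi> w \<le> t + K + 1"
proof -
  let ?L = "dist y x"
  obtain \<gamma> where iso: "\<And>u v. u \<in> {0..?L} \<Longrightarrow> v \<in> {0..?L} \<Longrightarrow> dist (\<gamma> u) (\<gamma> v) = \<bar>u - v\<bar>"
    and ends: "\<gamma> 0 = y" "\<gamma> ?L = x"
    using geod unfolding geodesic_space_def geodesic_segment_def by (metis UNIV_I)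
  define n where "n = nat \<lceil>?L\<rceil> + 1"
  have n: "0 < n" "?L \<le> n" unfolding n_def by linarith+
  define s where "s k = real k * (?L / n)" for k
  have s: "s k \<in> {0..?L}" if "k \<le> n" for k
  proof -
    have "real k * ?L \<le> real n * ?L" using that by (intro mult_right_mono) auto
    then show ?thesis using n unfolding s_def by (simp add: divide_simps mult.commute)
  qed
  have "s 0 = 0" "s n = ?L" using n unfolding s_def by auto
  define k where "k = (LEAST k. t \<le> \<Phi> (\<gamma> (s k)))"
  have "t \<le> \<Phi> (\<gamma> (s n))" using \<open>s n = ?L\<close> ends x by simp
  then have k: "t \<le> \<Phi> (\<gamma> (s k))" "k \<le> n" unfolding k_def by (rule LeastI, rule Least_le)
  have "k \<noteq> 0" using k(1) \<open>s 0 = 0\<close> ends y by (intro notI) simp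
  then have "\<not> t \<le> \<Phi> (\<gamma> (s (k - 1)))" unfolding k_def by (intro not_less_Least) simp
  moreover have "dist (\<gamma> (s k)) (\<gamma> (s (k - 1))) \<le> 1"
  proof -
    have "s k - s (k - 1) = ?L / n" using \<open>k \<noteq> 0\<close> unfolding s_def
      by (simp add: of_nat_diff left_diff_distrib diff_divide_distrib)
    moreover have "?L / n \<le> 1" using n by simp
    ultimately show ?thesis using iso[of "s k" "s (k - 1)"] s[of k] s[of "k - 1"] k(2) by simp
  qed
  ultimately have "\<Phi> (\<gamma> (s k)) \<le> t + K + 1" using \<Phi>[of "\<gamma> (s k)" "\<gamma> (s (k - 1))"] by linarith
  moreover have "dist y (\<gamma> (s k)) + dist (\<gamma> (s k)) x = ?L"
    using iso[of 0 "s k"] iso[of "s k" ?L] s[OF k(2)] ends by simp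
  ultimately show ?thesis using k(1) by blast
qed

text \<open>The gap \<open>2 * K + 1\<close> between the regions where the two summands vary makes the sum a contraction
  with the same constant \<open>K\<close>.\<close>

lemma K_contraction_glue:
  fixes \<Phi> \<Psi> :: "'x::metric_space \<Rightarrow> real"
  assumes geod: "geodesic_space (UNIV :: 'x set) dist" and K: "0 \<le> K"
    and \<Phi>: "K_contraction K \<mu> \<Phi>" and \<Psi>: "K_contraction K \<mu> \<Psi>"
    and sub: "\<And>x. t \<le> \<Phi> x \<Longrightarrow> R \<le> \<Psi> x"
  defines "T \<equiv> t + 2 * K + 1"
  shows "K_contraction K \<mu> (\<lambda>x. min (\<Psi> x) R + (max (\<Phi> x) T - T))"
proof -
  define A where "A x = min (\<Psi> x) R" for x
  define B where "B x = max (\<Phi> x) T - T" for x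
  have contr_A: "K_contraction K \<mu> A" unfolding A_def
    using \<Psi> by (rule K_contraction_comp[where f = "\<lambda>s. min s R"]) (auto simp: mono_def)
  have contr_B: "K_contraction K \<mu> B" unfolding B_def
    using \<Phi> by (rule K_contraction_comp[where f = "\<lambda>s. max s T - T"]) (auto simp: mono_def)
  have A: "A x \<le> R" and B: "0 \<le> B x" for x unfolding A_def B_def by auto
  have AB: "A x = R" if "t \<le> \<Phi> x" for x using sub[OF that] unfolding A_def by simp
  have B0: "B x = 0" if "A x < R" for x
    using AB[of x] that K unfolding B_def T_def by (cases "t \<le> \<Phi> x") auto
  have upper: "A x + B x - (A y + B y) \<le> dist x y + K" for x y
  proof (cases "0 < B x \<and> A y < R")
    case True
    then have "\<Phi> y < t" using AB[of y] by fastforce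
    moreover have "T < \<Phi> x" using True unfolding B_def by (simp add: max_def split: if_splits)
    ultimately obtain w where w: "dist y w + dist w x = dist y x" "t \<le> \<Phi> w" "\<Phi> w \<le> t + K + 1"
      using geodesic_crossing[OF geod K_contraction_dist[OF \<Phi>], of y t x] K unfolding T_def by fastforce
    \<comment> \<open>The gap supplies a surplus \<open>K\<close>, which pays for one of the two
      additive errors along the geodesic through \<open>w\<close>.\<close>
    have "B x \<le> \<Phi> x - \<Phi> w - K" using \<open>T < \<Phi> x\<close> w(3) unfolding B_def T_def by simp
    moreover have "\<Phi> x - \<Phi> w \<le> dist w x + K"
      using K_contraction_dist[OF \<Phi>, of x w] dist_commute[of x w] by linarith
    moreover have "A w - A y \<le> dist y w + K"
      using K_contraction_dist[OF contr_A, of w y] dist_commute[of w y] by linarith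
    moreover have "A w = R" "B y = 0" using AB[OF w(2)] B0 True by auto
    ultimately show ?thesis using A[of x] w(1) dist_commute[of x y] by linarith
  next
    case False
    then consider "B x = 0" | "A y = R" using A[of y] B[of x] by fastforce
    then show ?thesis
    proof cases
      case 1
      then show ?thesis using K_contraction_dist[OF contr_A, of x y] B[of y] by linarith
    next
      case 2
      then show ?thesis using K_contraction_dist[OF contr_B, of x y] A[of x] by linarith
    qed
  qed
  have "\<bar>A m + B m - real_median (A x + B x) (A y + B y) (A z + B z)\<bar> \<le> K" if m: "m = \<mu> x y z" for x y z m
  proof -
    let ?a = "real_median (A x) (A y) (A z)" and ?b = "real_median (B x) (B y) (B z)"
    let ?p = "real_median (\<Phi> x) (\<Phi> y) (\<Phi> z)"
    have mA: "\<bar>A m - ?a\<bar> \<le> K" and mB: "\<bar>B m - ?b\<bar> \<le> K" and mp: "\<bar>\<Phi> m - ?p\<bar> \<le> K"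
      using K_contraction_median contr_A contr_B \<Phi> unfolding m by blast+
    have b: "?b = max ?p T - T"
      unfolding B_def by (rule real_median_mono_comp[where f = "\<lambda>s. max s T - T"]) (auto simp: mono_def)
    \<comment> \<open>Both summands are monotone truncations of their sum, so their medians can be
      read off from the median of the sum.\<close>
    have split: "A u = min (A u + B u) R" "B u = max (A u + B u) R - R" for u
      using A[of u] B[of u] B0[of u] by (cases "A u < R"; simp add: min_def max_def)+
    let ?s = "real_median (A x + B x) (A y + B y) (A z + B z)"
    have a: "?a = min ?s R"
      by (subst (1 2 3) split(1)) (rule real_median_mono_comp[where f = "\<lambda>s. min s R"], auto simp: mono_def)
    have b': "?b = max ?s R - R"
      by (subst (1 2 3) split(2)) (rule real_median_mono_comp[where f = "\<lambda>s. max s R - R"], auto simp: mono_def)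
    show ?thesis
    proof (cases "?a < R")
      case True
      \<comment> \<open>If the median of \<open>A\<close> is below \<open>R\<close>, two of the
        arguments have \<open>A\<close> below \<open>R\<close> and thus \<open>\<Phi>\<close> below
        \<open>t\<close>.\<close>
      have "A u = R \<or> \<Phi> u < t" for u using AB[of u] by fastforce
      from this[of x] this[of y] this[of z] have "?p < t"
        using True A[of x] A[of y] A[of z] unfolding real_median_def by linarith
      then have "B m = 0" using mp K unfolding B_def T_def by simp
      then show ?thesis using mA a b' True by (simp add: min_def split: if_splits)
    next
      case False
      then have s: "?s = R + ?b" using a b' by (simp add: min_def max_def split: if_splits)
      show ?thesis
      proof (cases "0 < ?b")
        case True
        then have "T < ?p" using b by (simp add: max_def split: if_splits)
        then have "A m = R" using AB[of m] mp K unfolding T_def by simp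
        then show ?thesis using mB s by simp
      next
        case False
        moreover have "0 \<le> ?b" using b' by simp
        ultimately have "?b = 0" by simp
        \<comment> \<open>The two errors do not add up, since \<open>A m < R\<close> forces
          \<open>B m = 0\<close>.\<close>
        then show ?thesis using s mA mB a \<open>\<not> ?a < R\<close> A[of m] B[of m] B0[of m] by fastforce
      qed
    qed
  qed
  moreover have "\<bar>A x + B x - (A y + B y)\<bar> \<le> dist x y + K" for x y
    using upper[of x y] upper[of y x] dist_commute[of x y] by linarith
  ultimately show ?thesis
    unfolding K_contraction_def A_def[symmetric] B_def[symmetric] by blast
qed

subsection \<open>Balls of the contraction metric\<close>

locale contraction_system = coarse_median_system \<SS> D \<mu> trv \<kappa> N + contractions \<mu> K
  for \<SS> :: "'s set" and D :: "'s \<Rightarrow> 'x::metric_space \<Rightarrow> 'x \<Rightarrow> real" and \<mu> trv \<kappa> N K +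
  assumes geodesic: "geodesic_space (UNIV :: 'x set) dist"
begin

text \<open>Divided by \<open>c\<close>, the function \<open>x \<mapsto> D U a x - D U b x\<close>
  is a contraction; it varies by \<open>2 * D U a b\<close> between \<open>a\<close> and
  \<open>b\<close>. Since \<open>c * K\<close> is at least \<open>2 * \<kappa>\<close>, the additive
  errors fit into \<open>K\<close>.\<close>

lemma D_le_sigma: "\<exists>c\<ge>0. \<forall>U\<in>\<SS>. \<forall>a b. D U a b \<le> c * \<sigma> a b"
proof -
  define c where "c = 2 * \<kappa> + 2 * \<kappa> / K + 1"
  have "0 \<le> 2 * \<kappa> / K" "0 \<le> \<kappa> * K" using kappa_nonneg K_pos by simp_all
  moreover have "c * K = 2 * (\<kappa> * K) + 2 * \<kappa> + K" using K_pos by (simp add: c_def field_simps)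
  ultimately have c: "0 < c" "2 * \<kappa> \<le> c" "2 * \<kappa> \<le> c * K"
    using kappa_nonneg K_pos unfolding c_def by linarith+
  have "D U a b \<le> c * \<sigma> a b" if U: "U \<in> \<SS>" for U a b
  proof -
    interpret hyperbolic_median "D U" \<mu> \<kappa> by (rule hyp[OF U])
    define \<Phi> where "\<Phi> x = D U a x - D U b x" for x
    have mono: "mono (\<lambda>t. t / c)" using c(1) by (auto simp: mono_def divide_right_mono)
    have dist: "\<bar>\<Phi> x / c - \<Phi> y / c\<bar> \<le> dist x y + K" for x y
    proof -
      have "\<bar>\<Phi> x - \<Phi> y\<bar> \<le> 2 * D U x y"
        using triangle[of a x y] triangle[of a y x] triangle[of b x y] triangle[of b y x] sym[of x y]
        unfolding \<Phi>_def by linarith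
      also have "\<dots> \<le> 2 * \<kappa> * dist x y + 2 * \<kappa>" using lipschitz[OF U, of x y] by simp
      also have "\<dots> \<le> c * dist x y + c * K" using c by (intro add_mono mult_right_mono) auto
      finally have "\<bar>\<Phi> x - \<Phi> y\<bar> / c \<le> dist x y + K" using c(1) by (simp add: field_simps)
      then show ?thesis using c(1) by (simp add: diff_divide_distrib[symmetric])
    qed
    have med: "\<bar>\<Phi> (\<mu> x y z) / c - real_median (\<Phi> x / c) (\<Phi> y / c) (\<Phi> z / c)\<bar> \<le> K" for x y z
    proof -
      have "between \<kappa> x (\<mu> x y z) y" "between \<kappa> y (\<mu> x y z) z" "between \<kappa> x (\<mu> x y z) z"
        unfolding between_def by (rule med12 med23 med13)+
      note this[THEN distance_difference_between(1), of a b] this[THEN distance_difference_between(2), of a b]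
      then have "\<bar>\<Phi> (\<mu> x y z) - real_median (\<Phi> x) (\<Phi> y) (\<Phi> z)\<bar> \<le> 2 * \<kappa>"
        unfolding \<Phi>_def by (intro real_median_near; unfold mult_2)
      then have "\<bar>\<Phi> (\<mu> x y z) - real_median (\<Phi> x) (\<Phi> y) (\<Phi> z)\<bar> / c \<le> K"
        using c(1,3) by (simp add: field_simps)
      then show ?thesis
        using c(1) by (simp add: real_median_mono_comp[OF mono] diff_divide_distrib[symmetric])
    qed
    have "contr (\<lambda>x. \<Phi> x / c)" using dist med unfolding K_contraction_def by blast
    from contr_le_sigma[OF this, of b a] have "2 * D U a b / c \<le> \<sigma> a b"
      using refl sym[of a b] unfolding \<Phi>_def by (simp add: diff_divide_distrib[symmetric])
    then have "2 * D U a b \<le> c * \<sigma> a b" using c(1) by (simp add: field_simps)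
    then show ?thesis using nonneg[of a b] by linarith
  qed
  then show ?thesis using c(1) by (intro exI[of _ c]) auto
qed

text \<open>The second clause says that \<open>g\<close> is coarsely between \<open>b\<close> and
  each point of \<open>A\<close>, in terms of \<open>\<mu>\<close> and \<open>dist\<close> so that
  contractions can be applied.\<close>

definition gate :: "nat \<Rightarrow> real \<Rightarrow> 'x set \<Rightarrow> 'x \<Rightarrow> 'x \<Rightarrow> bool" where
  "gate n \<theta> A b g \<longleftrightarrow> (\<exists>q\<in>(median_join \<mu> ^^ n) A. dist g q \<le> \<theta>) \<and> (\<forall>x\<in>A. dist (\<mu> b x g) g \<le> \<theta>)"

lemma gates_exist: "\<exists>n. \<exists>\<theta>\<ge>0. \<forall>A b. A \<noteq> {} \<longrightarrow> (\<exists>g. gate n \<theta> A b g)"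
proof -
  from coarse_helly obtain c \<theta>1 n where
    helly: "\<forall>F p R. F \<noteq> {} \<and> (\<forall>A\<in>F. \<forall>B\<in>F. \<exists>q\<in>A \<inter> B. \<forall>W\<in>\<SS>. D W p q \<le> R) \<longrightarrow>
    (\<exists>z. (\<forall>A\<in>F. \<exists>q\<in>(median_join \<mu> ^^ n) A. dist z q \<le> \<theta>1) \<and>
         (\<forall>U\<in>\<SS>. \<exists>A\<in>F. \<forall>x\<in>A. D U p z + D U z x \<le> D U p x + c))"
    by (elim exE)
  obtain \<theta>2 where \<theta>2: "\<forall>x y. (\<forall>V\<in>\<SS>. D V x y \<le> c / 2 + \<kappa>) \<longrightarrow> dist x y \<le> \<theta>2"
    using uniqueness by blast
  define \<theta> where "\<theta> = max 0 (max \<theta>1 \<theta>2)"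
  have "\<exists>g. gate n \<theta> A b g" if "A \<noteq> {}" for A b
  proof -
    obtain q where q: "q \<in> A" using \<open>A \<noteq> {}\<close> by blast
    have "\<forall>W\<in>\<SS>. D W b q \<le> \<kappa> * dist b q + \<kappa>" using lipschitz by blast
    then have "{A} \<noteq> {} \<and> (\<forall>X\<in>{A}. \<forall>Y\<in>{A}. \<exists>q'\<in>X \<inter> Y. \<forall>W\<in>\<SS>. D W b q' \<le> \<kappa> * dist b q + \<kappa>)"
      using q by auto
    from helly[rule_format, OF this] obtain g
      where g: "\<exists>q\<in>(median_join \<mu> ^^ n) A. dist g q \<le> \<theta>1"
        and btw: "\<forall>U\<in>\<SS>. \<forall>x\<in>A. D U b g + D U g x \<le> D U b x + c"
      by auto
    have "dist (\<mu> b x g) g \<le> \<theta>2" if "x \<in> A" for x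
    proof (rule \<theta>2[rule_format])
      fix V assume V: "V \<in> \<SS>"
      have "hyperbolic_median.between (D V) c b g x"
        unfolding hyperbolic_median.between_def[OF hyp[OF V]] using btw V that by blast
      then show "D V (\<mu> b x g) g \<le> c / 2 + \<kappa>"
        by (rule hyperbolic_median.median_between(1)[OF hyp[OF V]])
    qed
    then have "gate n \<theta> A b g"
      using g unfolding gate_def \<theta>_def by (meson max.cobounded1 max.cobounded2 order_trans)
    then show ?thesis ..
  qed
  moreover have "0 \<le> \<theta>" unfolding \<theta>_def by simp
  ultimately show ?thesis by blast
qed

lemma gate_median:
  assumes "gate n \<theta> A b g" "x \<in> A" "contr \<Phi>"
  shows "\<bar>\<Phi> g - real_median (\<Phi> b) (\<Phi> x) (\<Phi> g)\<bar> \<le> \<theta> + 2 * K"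
  using assms(1,2) K_contraction_dist[OF assms(3), of "\<mu> b x g" g]
    K_contraction_median[OF assms(3), of b x g] unfolding gate_def by fastforce

lemma gate_ball_dist:
  assumes "gate n \<theta> {x. \<sigma> a x \<le> r} b g"
  shows "\<sigma> a g \<le> r + n * K + \<theta> + K"
proof -
  obtain q where "q \<in> (median_join \<mu> ^^ n) {x. \<sigma> a x \<le> r}" "dist g q \<le> \<theta>"
    using assms unfolding gate_def by blast
  then show ?thesis
    using sigma_ball_join[of q n a r] sigma_triangle[of a g q] sigma_le_dist[of q g]
    by (simp add: dist_commute)
qed

text \<open>If a contraction \<open>\<Phi>\<close> moves far between the gate and \<open>y\<close>, then it is small on the ball, so a
  superlevel set of \<open>\<Phi>\<close> is disjoint from the ball. A contraction which is large at the gate of \<open>a\<close>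
  to that superlevel set is large on all of it, and gluing it with \<open>\<Phi>\<close> bounds \<open>\<sigma> a y\<close> from below.\<close>

lemma gate_distance:
  assumes "0 \<le> \<theta>" and gates: "\<forall>A b. A \<noteq> {} \<longrightarrow> (\<exists>g. gate n \<theta> A b g)" and "0 \<le> k"
  shows "\<exists>c\<ge>0. \<forall>a b r g y. 0 \<le> r \<and> gate n \<theta> {x. \<sigma> a x \<le> r} b g \<and>
    (\<forall>\<Phi>. contr \<Phi> \<longrightarrow> \<Phi> y \<le> max (\<Phi> g) (\<Phi> b) + k) \<longrightarrow> \<sigma> g y \<le> max 0 (\<sigma> a y - r) + c"
proof -
  \<comment> \<open>\<open>k2\<close> is the error of \<open>gate_median\<close>, \<open>k4\<close>
    that of \<open>gate_ball_dist\<close>. The level \<open>t\<close> keeps \<open>\<Phi> h\<close>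
    above \<open>k2\<close> despite the joins, and \<open>T\<close> leaves the gap needed for
    gluing.\<close>
  define k2 where "k2 = \<theta> + 2 * K"
  define k4 where "k4 = n * K + \<theta> + K"
  define t where "t = k2 + k4 + 1"
  define T where "T = t + 2 * K + 1"
  define c where "c = 2 * k2 + k4 + T + k"
  have "0 \<le> n * K" using K_pos by simp
  then have pos: "0 < k2" "0 < k4" "k2 < t" "k2 < T" "t < T"
    using assms(1,3) K_pos unfolding k2_def k4_def t_def T_def by linarith+
  then have "0 \<le> c" using assms(3) unfolding c_def by linarith
  have "\<sigma> g y \<le> max 0 (\<sigma> a y - r) + c"
    if r: "0 \<le> r" and g: "gate n \<theta> {x. \<sigma> a x \<le> r} b g"
      and y: "\<forall>\<Phi>. contr \<Phi> \<longrightarrow> \<Phi> y \<le> max (\<Phi> g) (\<Phi> b) + k" for a b r g y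
  proof (cases "r < k2")
    case True
    then show ?thesis
      using sigma_triangle[of g y a] gate_ball_dist[OF g] sigma_sym[of a g] pos assms(3)
      unfolding c_def k4_def by linarith
  next
    case False
    show ?thesis
    proof (rule sigma_leI)
      fix \<Phi> assume \<Phi>: "contr \<Phi>" "\<Phi> g = 0"
      show "\<Phi> y \<le> max 0 (\<sigma> a y - r) + c"
      proof (cases "\<Phi> y \<le> T + k")
        case True
        then show ?thesis using pos unfolding c_def by linarith
      next
        case False
        then have b: "T \<le> \<Phi> b" using y \<Phi> pos assms(3) by fastforce
        \<comment> \<open>As \<open>g\<close> is between \<open>b\<close> and \<open>x\<close>, the
          median of \<open>\<Phi> b\<close>, \<open>\<Phi> x\<close> and \<open>\<Phi> g = 0\<close>
          is almost 0; since \<open>\<Phi> b\<close> is large, \<open>\<Phi> x\<close> cannot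
          be.\<close>
        have small: "\<Phi> x \<le> k2" if "\<sigma> a x \<le> r" for x
          using gate_median[OF g _ \<Phi>(1), of x] that \<Phi>(2) b pos
          unfolding k2_def[symmetric] real_median_def by (auto simp: max_def min_def split: if_splits)
        have "b \<in> {x. t \<le> \<Phi> x}" using b pos by simp
        then have "{x. t \<le> \<Phi> x} \<noteq> {}" by blast
        from gates[rule_format, OF this] obtain h where h: "gate n \<theta> {x. t \<le> \<Phi> x} a h" ..
        from h obtain q where "q \<in> (median_join \<mu> ^^ n) {x. t \<le> \<Phi> x}" "dist h q \<le> \<theta>"
          unfolding gate_def by (elim conjE bexE)
        then have "k2 < \<Phi> h"
          using superlevel_join[OF \<Phi>(1), of q n t] K_contraction_dist[OF \<Phi>(1), of h q]
          unfolding t_def k4_def by linarith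
        then have "r < \<sigma> a h" using small[of h] by linarith
        then obtain \<Psi> where \<Psi>: "contr \<Psi>" "\<Psi> a = 0" "r < \<Psi> h" using sigma_greater by blast
        \<comment> \<open>Dually, \<open>h\<close> is between \<open>a\<close> and \<open>x\<close>;
          as \<open>\<Psi> a = 0\<close> and \<open>\<Psi> h\<close> exceeds \<open>r\<close>,
          \<open>\<Psi> x\<close> nearly reaches \<open>r\<close>.\<close>
        have large: "r - k2 \<le> \<Psi> x" if "t \<le> \<Phi> x" for x
          using gate_median[OF h _ \<Psi>(1), of x] that \<Psi>(2,3) \<open>\<not> r < k2\<close> pos
            real_median_le_max(1)[of "\<Psi> a" "\<Psi> x" "\<Psi> h"]
          unfolding k2_def[symmetric] by auto
        let ?\<Theta> = "\<lambda>x. min (\<Psi> x) (r - k2) + (max (\<Phi> x) T - T)"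
        have "contr ?\<Theta>"
          using K_contraction_glue[OF geodesic _ \<Phi>(1) \<Psi>(1) large] K_pos unfolding T_def by simp
        from contr_le_sigma[OF this, of y a]
        have "?\<Theta> y - ?\<Theta> a \<le> \<sigma> a y" .
        moreover have "?\<Theta> a = 0"
          using small[of a] sigma_self r \<Psi>(2) \<open>\<not> r < k2\<close> pos by simp
        moreover have "?\<Theta> y = r - k2 + \<Phi> y - T"
          using large[of y] \<open>\<not> \<Phi> y \<le> T + k\<close> pos assms(3) by simp
        ultimately show ?thesis using pos assms(3) unfolding c_def by linarith
      qed
    qed
  qed
  then show ?thesis using \<open>0 \<le> c\<close> by blast
qed

text \<open>\<open>g a b t\<close> is the gate of \<open>b\<close> in the ball of radius
  \<open>t\<close> about \<open>a\<close>. Gates overshoot their ball, and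
  \<open>s + c \<le> t\<close> ensures that the gate for \<open>s\<close> still lies in the ball for
  \<open>t\<close>. The later gate is then between the earlier one and \<open>b\<close>, as
  \<open>gate_distance\<close> requires of \<open>y\<close>.\<close>

lemma ball_gates:
  "\<exists>c\<ge>0. \<exists>g. \<forall>a b t. 0 \<le> t \<longrightarrow> \<sigma> a (g a b t) \<le> t + c \<and> \<sigma> (g a b t) b \<le> max 0 (\<sigma> a b - t) + c \<and>
    (\<forall>s. 0 \<le> s \<and> s + c \<le> t \<longrightarrow> \<sigma> (g a b s) (g a b t) \<le> t - s + c)"
proof -
  obtain n \<theta> where "0 \<le> \<theta>" and gates: "\<forall>A b. A \<noteq> {} \<longrightarrow> (\<exists>g. gate n \<theta> A b g)"
    using gates_exist by blast
  define k where "k = \<theta> + 2 * K"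
  define k4 where "k4 = n * K + \<theta> + K"
  have "0 \<le> k" "0 \<le> k4" using \<open>0 \<le> \<theta>\<close> K_pos by (auto simp: k_def k4_def)
  from gate_distance[OF \<open>0 \<le> \<theta>\<close> gates \<open>0 \<le> k\<close>] obtain c where "0 \<le> c"
    and c: "\<forall>a b r g y. 0 \<le> r \<and> gate n \<theta> {x. \<sigma> a x \<le> r} b g \<and>
      (\<forall>\<Phi>. contr \<Phi> \<longrightarrow> \<Phi> y \<le> max (\<Phi> g) (\<Phi> b) + k) \<longrightarrow> \<sigma> g y \<le> max 0 (\<sigma> a y - r) + c"
    by (elim exE conjE)
  define g where "g a b t = (SOME g. gate n \<theta> {x. \<sigma> a x \<le> t} b g)" for a b t
  have g: "gate n \<theta> {x. \<sigma> a x \<le> t} b (g a b t)" if "0 \<le> t" for a b t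
  proof -
    have "a \<in> {x. \<sigma> a x \<le> t}" using that sigma_self[of a] by simp
    then have "{x. \<sigma> a x \<le> t} \<noteq> {}" by blast
    from gates[rule_format, OF this, of b] show ?thesis unfolding g_def by (rule someI_ex)
  qed
  have near: "\<sigma> a (g a b t) \<le> t + k4" if "0 \<le> t" for a b t
    using gate_ball_dist[OF g[OF that]] unfolding k4_def by (simp add: algebra_simps)
  have "\<sigma> a (g a b t) \<le> t + (k4 + c)" "\<sigma> (g a b t) b \<le> max 0 (\<sigma> a b - t) + (k4 + c)"
    and "\<And>s. 0 \<le> s \<Longrightarrow> s + (k4 + c) \<le> t \<Longrightarrow> \<sigma> (g a b s) (g a b t) \<le> t - s + (k4 + c)"
    if t: "0 \<le> t" for a b t
  proof -
    show "\<sigma> a (g a b t) \<le> t + (k4 + c)" using near[OF t, of a b] \<open>0 \<le> c\<close> by simp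
    have "0 \<le> t \<and> gate n \<theta> {x. \<sigma> a x \<le> t} b (g a b t) \<and>
        (\<forall>\<Phi>. contr \<Phi> \<longrightarrow> \<Phi> b \<le> max (\<Phi> (g a b t)) (\<Phi> b) + k)"
      using t g[OF t] \<open>0 \<le> k\<close> by (simp add: add_increasing2)
    from c[rule_format, OF this] have "\<sigma> (g a b t) b \<le> max 0 (\<sigma> a b - t) + c" .
    then show "\<sigma> (g a b t) b \<le> max 0 (\<sigma> a b - t) + (k4 + c)" using \<open>0 \<le> k4\<close> by simp
    fix s assume s: "0 \<le> s" "s + (k4 + c) \<le> t"
    have "g a b s \<in> {x. \<sigma> a x \<le> t}" using near[OF s(1), of a b] s(2) \<open>0 \<le> c\<close> by simp
    note med = gate_median[OF g[OF t, of a b] this, folded k_def]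
    have "\<Phi> (g a b t) \<le> max (\<Phi> (g a b s)) (\<Phi> b) + k" if "contr \<Phi>" for \<Phi>
      using med[OF that] real_median_le_max(1)[of "\<Phi> b" "\<Phi> (g a b s)" "\<Phi> (g a b t)"] by linarith
    then have "0 \<le> s \<and> gate n \<theta> {x. \<sigma> a x \<le> s} b (g a b s) \<and>
        (\<forall>\<Phi>. contr \<Phi> \<longrightarrow> \<Phi> (g a b t) \<le> max (\<Phi> (g a b s)) (\<Phi> b) + k)"
      using s(1) g[OF s(1)] by simp
    from c[rule_format, OF this] have "\<sigma> (g a b s) (g a b t) \<le> max 0 (\<sigma> a (g a b t) - s) + c" .
    then show "\<sigma> (g a b s) (g a b t) \<le> t - s + (k4 + c)"
      using near[OF t, of a b] s \<open>0 \<le> c\<close> \<open>0 \<le> k4\<close> by linarith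
  qed
  then show ?thesis using \<open>0 \<le> c\<close> \<open>0 \<le> k4\<close>
    by (intro exI[of _ "k4 + c"] conjI exI[of _ g]) simp_all
qed

section \<open>Rough geodesics and common points of families of balls\<close>

theorem roughly_geodesic_sigma: "roughly_geodesic UNIV \<sigma>"
proof -
  from ball_gates obtain c g where "0 \<le> c" and
    "\<forall>a b t. 0 \<le> t \<longrightarrow> \<sigma> a (g a b t) \<le> t + c \<and> \<sigma> (g a b t) b \<le> max 0 (\<sigma> a b - t) + c \<and>
    (\<forall>s. 0 \<le> s \<and> s + c \<le> t \<longrightarrow> \<sigma> (g a b s) (g a b t) \<le> t - s + c)"
    by (elim exE conjE)
  then have g: "\<sigma> a (g a b t) \<le> t + c" "\<sigma> (g a b t) b \<le> max 0 (\<sigma> a b - t) + c"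
    "0 \<le> s \<Longrightarrow> s + c \<le> t \<Longrightarrow> \<sigma> (g a b s) (g a b t) \<le> t - s + c" if "0 \<le> t" for a b s t
    using that by blast+
  have "\<exists>f. qi_embedded_interval 1 (7 * c) UNIV \<sigma> (\<sigma> a b) f \<and> f 0 = a \<and> f (\<sigma> a b) = b" for a b
  proof -
    \<comment> \<open>The ends must be exactly \<open>a\<close> and \<open>b\<close>; the gates
      there are only within \<open>c\<close> of them.\<close>
    define f where "f t = (if t = 0 then a else if t = \<sigma> a b then b else g a b t)" for t
    have f: "\<sigma> (f t) (g a b t) \<le> c" if "0 \<le> t" for t
      using g(1)[of 0 a b] g(2)[of t a b] that sigma_self[of "g a b t"] sigma_sym[of b "g a b t"] \<open>0 \<le> c\<close>
      unfolding f_def by auto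
    have *: "t - s - 7 * c \<le> \<sigma> (f s) (f t) \<and> \<sigma> (f s) (f t) \<le> t - s + 7 * c"
      if "0 \<le> s" "s \<le> t" "t \<le> \<sigma> a b" for s t
    proof -
      let ?g = "g a b"
      \<comment> \<open>The distance estimate needs parameters at least \<open>c\<close> apart, so
        \<open>s\<close> and \<open>t\<close> are both compared with \<open>t + c\<close>.\<close>
      have "\<sigma> (?g s) (?g t) \<le> \<sigma> (?g s) (?g (t + c)) + \<sigma> (?g t) (?g (t + c))"
        using sigma_triangle[of "?g s" "?g t" "?g (t + c)"] sigma_sym[of "?g t"] by simp
      also have "\<dots> \<le> (t - s + 2 * c) + 2 * c"
        using g(3)[of "t + c" s a b] g(3)[of "t + c" t a b] that \<open>0 \<le> c\<close> by simp
      finally have upper: "\<sigma> (?g s) (?g t) \<le> t - s + 4 * c" by simp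
      have "\<sigma> a b \<le> \<sigma> a (?g s) + \<sigma> (?g s) (?g t) + \<sigma> (?g t) b"
        using sigma_triangle[of a b "?g s"] sigma_triangle[of "?g s" b "?g t"] by simp
      then have lower: "t - s - 2 * c \<le> \<sigma> (?g s) (?g t)"
        using g(1)[of s a b] g(2)[of t a b] that by simp
      have "\<bar>\<sigma> (f s) (f t) - \<sigma> (?g s) (?g t)\<bar> \<le> 2 * c"
        using f[of s] f[of t] that sigma_triangle[of "f s" "f t" "?g s"] sigma_triangle[of "?g s" "f t" "?g t"]
          sigma_triangle[of "?g s" "?g t" "f s"] sigma_triangle[of "f s" "?g t" "f t"]
          sigma_sym[of "f s" "?g s"] sigma_sym[of "f t" "?g t"] by linarith
      then show ?thesis using upper lower \<open>0 \<le> c\<close> by linarith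
    qed
    have "qi_embedded_interval 1 (7 * c) UNIV \<sigma> (\<sigma> a b) f"
      unfolding qi_embedded_interval_def
    proof (intro conjI ballI)
      fix s t assume "s \<in> {0..\<sigma> a b}" "t \<in> {0..\<sigma> a b}"
      then show "\<bar>s - t\<bar> / 1 - 7 * c \<le> \<sigma> (f s) (f t)" "\<sigma> (f s) (f t) \<le> 1 * \<bar>s - t\<bar> + 7 * c"
        using *[of s t] *[of t s] sigma_sym[of "f s" "f t"] by (auto simp: abs_if)
    qed simp
    moreover have "f 0 = a" "f (\<sigma> a b) = b"
      using sigma_pos[of a b] unfolding f_def by force+
    ultimately show ?thesis by blast
  qed
  then show ?thesis
    unfolding roughly_geodesic_def using Metric_space_sigma \<open>0 \<le> c\<close>
    by (intro conjI exI[of _ "7 * c"]) simp_all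
qed

theorem coarsely_injective_sigma: "coarsely_injective UNIV \<sigma>"
proof -
  from coarse_helly obtain c1 \<theta> n where
    helly: "\<forall>F p R. F \<noteq> {} \<and> (\<forall>A\<in>F. \<forall>B\<in>F. \<exists>q\<in>A \<inter> B. \<forall>W\<in>\<SS>. D W p q \<le> R) \<longrightarrow>
    (\<exists>z. (\<forall>A\<in>F. \<exists>q\<in>(median_join \<mu> ^^ n) A. dist z q \<le> \<theta>) \<and>
         (\<forall>U\<in>\<SS>. \<exists>A\<in>F. \<forall>x\<in>A. D U p z + D U z x \<le> D U p x + c1))"
    by (elim exE)
  obtain l where "0 \<le> l" and l: "\<And>U a b. U \<in> \<SS> \<Longrightarrow> D U a b \<le> l * \<sigma> a b"
    using D_le_sigma by blast
  from ball_gates obtain c g where "0 \<le> c" and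
    g: "\<forall>a b t. 0 \<le> t \<longrightarrow> \<sigma> a (g a b t) \<le> t + c \<and> \<sigma> (g a b t) b \<le> max 0 (\<sigma> a b - t) + c \<and>
    (\<forall>s. 0 \<le> s \<and> s + c \<le> t \<longrightarrow> \<sigma> (g a b s) (g a b t) \<le> t - s + c)"
    by (elim exE conjE)
  have mid: "\<exists>p. \<sigma> a p \<le> r + c \<and> \<sigma> b p \<le> s + c" if "0 \<le> r" "0 \<le> s" "\<sigma> a b \<le> r + s" for a b r s
  proof -
    have "\<sigma> a (g a b r) \<le> r + c" "\<sigma> (g a b r) b \<le> max 0 (\<sigma> a b - r) + c" using g that(1) by blast+
    then show ?thesis using that sigma_sym[of b "g a b r"] by (intro exI[of _ "g a b r"]) auto
  qed
  define k where "k = c + K + n * K + \<bar>\<theta>\<bar> + K"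
  have "0 \<le> k" using \<open>0 \<le> c\<close> K_pos by (simp add: k_def)
  show ?thesis
    unfolding coarsely_injective_def
  proof (intro conjI exI[of _ "k + 2 * c"] allI impI Metric_space_sigma)
    show "0 \<le> k + 2 * c" using \<open>0 \<le> k\<close> \<open>0 \<le> c\<close> by simp
    fix A :: "('x \<times> real) set"
    assume "(\<forall>(x, r)\<in>A. x \<in> UNIV) \<and> (\<forall>(x, r)\<in>A. \<forall>(y, s)\<in>A. \<sigma> x y \<le> r + s)"
    then have A: "\<sigma> x y \<le> r + s" if "(x, r) \<in> A" "(y, s) \<in> A" for x r y s using that by blast
    have r0: "0 \<le> r" if "(x, r) \<in> A" for x r using A[OF that that] sigma_self[of x] by simp
    have "\<exists>z. \<forall>(x, r)\<in>A. \<sigma> x z \<le> r + k"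
    proof (cases "A = {}")
      case False
      then obtain x0 s0 where x0: "(x0, s0) \<in> A" by auto
      \<comment> \<open>The radii grow by \<open>c\<close> to contain the points \<open>P\<close>
        and by \<open>K\<close> to contain medians of them.\<close>
      define Q where "Q i = {p. \<sigma> (fst i) p \<le> snd i + c + K}" for i
      have "\<forall>i\<in>A. \<forall>j\<in>A. \<exists>p. \<sigma> (fst i) p \<le> snd i + c \<and> \<sigma> (fst j) p \<le> snd j + c"
        using mid A r0 by (metis prod.collapse)
      then obtain P where P: "\<sigma> (fst i) (P i j) \<le> snd i + c" "\<sigma> (fst j) (P i j) \<le> snd j + c"
        if "i \<in> A" "j \<in> A" for i j by metis
      let ?o = "(x0, s0)"
      let ?b = "l * (s0 + c)"
      have "\<exists>q\<in>Q i \<inter> Q j. \<forall>W\<in>\<SS>. D W x0 q \<le> 3 * ?b + \<kappa>" if ij: "i \<in> A" "j \<in> A" for i j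
      proof (intro bexI[of _ "\<mu> (P ?o i) (P ?o j) (P i j)"] ballI)
        \<comment> \<open>Radii are unbounded, so \<open>P i j\<close> may be far from
          \<open>x0\<close>. Of the three arguments of the median, two lie in the enlarged ball of
          \<open>i\<close>, two in that of \<open>j\<close>, and two near \<open>x0\<close>.\<close>
        let ?q = "\<mu> (P ?o i) (P ?o j) (P i j)"
        show "?q \<in> Q i \<inter> Q j"
          using sigma_median(3)[of "fst i" "P ?o i" "P ?o j" "P i j"]
            sigma_median(2)[of "fst j" "P ?o i" "P ?o j" "P i j"]
            P(2)[OF x0 ij(1)] P(2)[OF x0 ij(2)] P[OF ij] unfolding Q_def by auto
        fix W assume W: "W \<in> \<SS>"
        have b: "D W x0 (P ?o i') \<le> ?b" if "i' \<in> A" for i'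
          using l[OF W, of x0 "P ?o i'"] mult_left_mono[OF P(1)[OF x0 that] \<open>0 \<le> l\<close>] by simp
        show "D W x0 ?q \<le> 3 * ?b + \<kappa>"
          using b[OF ij(1)] b[OF ij(2)] D_triangle[OF W, of x0 ?q "P ?o i"]
            D_triangle[OF W, of "P ?o i" "P ?o j" x0] D_sym[OF W, of "P ?o i" x0]
            hyperbolic_median.med12[OF hyp[OF W], of "P ?o i" "P ?o j" "P i j"]
            D_nonneg[OF W, of ?q "P ?o j"] by linarith
      qed
      then have "Q ` A \<noteq> {} \<and> (\<forall>X\<in>Q ` A. \<forall>Y\<in>Q ` A. \<exists>q\<in>X \<inter> Y. \<forall>W\<in>\<SS>. D W x0 q \<le> 3 * ?b + \<kappa>)"
        using False by blast
      from helly[rule_format, OF this] obtain z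
        where z: "\<forall>i\<in>A. \<exists>q\<in>(median_join \<mu> ^^ n) (Q i). dist z q \<le> \<theta>" by blast
      have "\<sigma> x z \<le> r + k" if xr: "(x, r) \<in> A" for x r
      proof -
        obtain q where "q \<in> (median_join \<mu> ^^ n) {p. \<sigma> x p \<le> r + c + K}" "dist z q \<le> \<theta>"
          using bspec[OF z xr] unfolding Q_def by auto
        then show ?thesis
          using sigma_ball_join[of q n x "r + c + K"] sigma_triangle[of x z q] sigma_le_dist[of q z]
            dist_commute[of q z] unfolding k_def by linarith
      qed
      then show ?thesis by blast
    qed simp
    then obtain z where z: "\<And>x r. (x, r) \<in> A \<Longrightarrow> \<sigma> x z \<le> r + k" by blast
    have "z \<in> thickening UNIV \<sigma> (k + 2 * c) (Metric_space.mcball UNIV \<sigma> x r)" if xr: "(x, r) \<in> A" for x r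
    proof -
      have "\<exists>y. \<sigma> x y \<le> r \<and> \<sigma> z y \<le> k + 2 * c"
      \<comment> \<open>To get back into the ball, \<open>mid\<close> is used with radii
        \<open>r - c\<close> and \<open>k + c\<close>, which still add up to \<open>r + k\<close>.
        For \<open>r < c\<close> the centre itself is near enough.\<close>
      proof (cases "c \<le> r")
        case True
        then have "\<exists>p. \<sigma> x p \<le> (r - c) + c \<and> \<sigma> z p \<le> (k + c) + c"
          using z[OF xr] \<open>0 \<le> k\<close> \<open>0 \<le> c\<close> by (intro mid) auto
        then show ?thesis by (simp add: add.commute)
      next
        case False
        then show ?thesis using r0[OF xr] z[OF xr] sigma_self[of x] sigma_sym[of x z] \<open>0 \<le> c\<close>
          by (intro exI[of _ x]) simp
      qed
      then show ?thesis
        unfolding thickening_def Bex_def Metric_space.in_mcball[OF Metric_space_sigma] by auto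
    qed
    then show "\<exists>z\<in>UNIV. \<forall>(x, r)\<in>A. z \<in> thickening UNIV \<sigma> (k + 2 * c) (Metric_space.mcball UNIV \<sigma> x r)"
      by blast
  qed
qed

end

subsection \<open>Hierarchically hyperbolic spaces as coarse median systems\<close>

context hhs
begin

section \<open>Nesting heights and the counting of domains\<close>

lemma nest_refl: "U \<in> \<SS> \<Longrightarrow> U \<sqsubseteq> U"
  using refl_onD[OF partial_order_onD(1)[OF nest_partial_order]] by simp

lemma nest_trans: "U \<sqsubseteq> V \<Longrightarrow> V \<sqsubseteq> W \<Longrightarrow> U \<sqsubseteq> W"
  using transD[OF partial_order_onD(2)[OF nest_partial_order], of U V W] by simp

lemma nest_antisym: "U \<sqsubseteq> V \<Longrightarrow> V \<sqsubseteq> U \<Longrightarrow> U = V"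
  using antisymD[OF partial_order_onD(3)[OF nest_partial_order], of U V] by simp

lemma nest_in: "U \<sqsubseteq> V \<Longrightarrow> U \<in> \<SS> \<and> V \<in> \<SS>"
  using subsetD[OF partial_order_onD(4)[OF nest_partial_order], of "(U, V)"] by simp

definition nest_chain :: "'s set \<Rightarrow> bool" where
  "nest_chain A \<longleftrightarrow> A \<subseteq> \<SS> \<and> (\<forall>U\<in>A. \<forall>V\<in>A. U \<sqsubseteq> V \<or> V \<sqsubseteq> U)"

lemma nest_chain_finite:
  assumes "nest_chain A"
  shows "finite A" "card A \<le> nat \<lfloor>E\<rfloor>"
proof -
  have "finite A \<and> real (card A) \<le> E"
    using assms unfolding nest_chain_def by (elim conjE) (rule finite_complexity)
  then show "finite A" "card A \<le> nat \<lfloor>E\<rfloor>" by (simp_all add: le_nat_floor)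
qed

text \<open>Finite complexity bounds these cardinalities, so the maximum exists. Height grows
  strictly under proper nesting and serves as bound and induction parameter when counting
  domains.\<close>

definition height :: "'s \<Rightarrow> nat" where
  "height U = Max (card ` {A. nest_chain A \<and> (\<forall>V\<in>A. V \<sqsubseteq> U)})"

lemma chain_cards: "finite (card ` {A. nest_chain A \<and> (\<forall>V\<in>A. V \<sqsubseteq> U)})"
proof (rule finite_subset)
  show "card ` {A. nest_chain A \<and> (\<forall>V\<in>A. V \<sqsubseteq> U)} \<subseteq> {..nat \<lfloor>E\<rfloor>}"
    using nest_chain_finite(2) by (intro image_subsetI) simp
qed simp

lemma card_le_height: "nest_chain A \<Longrightarrow> \<forall>V\<in>A. V \<sqsubseteq> U \<Longrightarrow> card A \<le> height U"
  unfolding height_def by (rule Max_ge[OF chain_cards]) simp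

lemma height_attained: "\<exists>A. nest_chain A \<and> (\<forall>V\<in>A. V \<sqsubseteq> U) \<and> card A = height U"
proof -
  have "card ` {A. nest_chain A \<and> (\<forall>V\<in>A. V \<sqsubseteq> U)} \<noteq> {}" by (auto simp: nest_chain_def)
  from Max_in[OF chain_cards this] show ?thesis unfolding height_def by auto
qed

lemma height_le: "height U \<le> nat \<lfloor>E\<rfloor>"
proof -
  from height_attained[of U] obtain A where "nest_chain A" "card A = height U" by (elim exE conjE)
  then show ?thesis using nest_chain_finite(2)[of A] by simp
qed

lemma height_less:
  assumes "U \<sqsubset> V"
  shows "height U < height V"
proof -
  have UV: "U \<sqsubseteq> V" "U \<noteq> V" using assms by (auto simp: proper_nest_def)
  obtain A where A: "nest_chain A" "\<forall>W\<in>A. W \<sqsubseteq> U" "card A = height U"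
    using height_attained[of U] by (elim exE conjE)
  have below: "W \<sqsubseteq> V" if "W \<in> insert V A" for W
    using that A(2) nest_trans[OF _ UV(1)] nest_refl[of V] nest_in[OF UV(1)] by blast
  then have "nest_chain (insert V A)"
    using A(1) nest_in[OF UV(1)] unfolding nest_chain_def by blast
  moreover have "V \<notin> A" using A(2) nest_antisym UV by blast
  ultimately show ?thesis
    using card_le_height[of "insert V A" V] below A(3) nest_chain_finite(1)[OF A(1)] by simp
qed

text \<open>The axiom only speaks of maximal elements. A domain of greatest height containing
  \<open>U\<close> is maximal, so uniqueness identifies it with \<open>S\<close>.\<close>

lemma exists_top:
  assumes "\<SS> \<noteq> {}"
  shows "\<exists>S\<in>\<SS>. \<forall>U\<in>\<SS>. U \<sqsubseteq> S"
proof -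
  obtain S where S: "S \<in> \<SS>" and uniq: "\<And>V. V \<in> \<SS> \<Longrightarrow> \<forall>U\<in>\<SS>. V \<sqsubseteq> U \<longrightarrow> U = V \<Longrightarrow> V = S"
    using unique_maximal[OF assms] by (elim ex1E) blast
  have "U \<sqsubseteq> S" if U: "U \<in> \<SS>" for U
  proof -
    let ?P = "\<lambda>V. U \<sqsubseteq> V"
    have "\<exists>V. ?P V \<and> (\<forall>W. ?P W \<longrightarrow> height W \<le> height V)"
      using nest_refl[OF U] height_le
      by (intro ex_has_greatest_nat[where P = ?P and b = "Suc (nat \<lfloor>E\<rfloor>)"]) (auto simp: less_Suc_eq_le)
    then obtain V where V: "U \<sqsubseteq> V" and mx: "\<forall>W. U \<sqsubseteq> W \<longrightarrow> height W \<le> height V" by (elim exE conjE)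
    have "\<forall>W\<in>\<SS>. V \<sqsubseteq> W \<longrightarrow> W = V"
    proof (intro ballI impI)
      fix W assume "V \<sqsubseteq> W"
      then show "W = V"
        using height_less[of V W] mx[rule_format, OF nest_trans[OF V]] unfolding proper_nest_def by force
    qed
    then have "V = S" using uniq nest_in[OF V] by simp
    then show ?thesis using V by simp
  qed
  then show ?thesis using S by blast
qed

text \<open>Applying the container axiom repeatedly to pairwise orthogonal domains yields a chain.\<close>

lemma orthogonal_bound_aux:
  "finite A \<Longrightarrow> pairwise (\<bottom>) A \<Longrightarrow> \<forall>V\<in>A. V \<sqsubseteq> T \<Longrightarrow> card A \<le> height T"
proof (induction A arbitrary: T rule: finite_induct)
  case empty
  then show ?case by simp
next
  case (insert U A)
  show ?case
  proof (cases "A = {}")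
    case True
    then show ?thesis
      using card_le_height[of "{U}" T] insert.prems(2) nest_in nest_refl by (auto simp: nest_chain_def)
  next
    case False
    have orth: "V \<bottom> U" if "V \<in> A" for V
      using pairwiseD[OF insert.prems(1), of V U] insert.hyps(2) that by auto
    obtain V0 where "V0 \<in> A" using False by blast
    then have "V0 \<sqsubseteq> T \<and> V0 \<bottom> U" using orth insert.prems(2) by simp
    then have ex: "\<exists>V. V \<sqsubseteq> T \<and> V \<bottom> U" ..
    have "U \<sqsubseteq> T" using insert.prems(2) by simp
    from orth_container[OF this ex] obtain W
      where W: "W \<sqsubset> T" "\<forall>V. V \<sqsubseteq> T \<and> V \<bottom> U \<longrightarrow> V \<sqsubseteq> W"
      by (elim exE conjE)
    have "card A \<le> height W"
      using insert.prems W(2) orth by (intro insert.IH) (auto simp: pairwise_insert)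
    then show ?thesis using height_less[OF W(1)] insert.hyps by simp
  qed
qed

lemma orthogonal_bound:
  assumes "A \<subseteq> \<SS>" "finite A" "pairwise (\<bottom>) A"
  shows "card A \<le> nat \<lfloor>E\<rfloor>"
proof (cases "A = {}")
  case False
  then obtain S where "\<forall>U\<in>\<SS>. U \<sqsubseteq> S" using exists_top assms(1) by blast
  then show ?thesis using orthogonal_bound_aux[OF assms(2,3), of S] assms(1) height_le[of S] by force
qed simp

text \<open>Domains containing a common domain are not orthogonal, so the set is a forest under nesting;
  its levels are pairwise orthogonal.\<close>

lemma nontransverse_bound:
  assumes A: "A \<subseteq> \<SS>" "finite A" "pairwise (\<lambda>U V. \<not> transverse U V) A"
  shows "card A \<le> nat \<lfloor>E\<rfloor> * nat \<lfloor>E\<rfloor>"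
proof -
  define up where "up U = {V\<in>A. U \<sqsubseteq> V}" for U
  have cases: "U \<bottom> V \<or> U \<sqsubseteq> V \<or> V \<sqsubseteq> U" if "U \<in> A" "V \<in> A" for U V
    using A that nest_refl unfolding pairwise_def transverse_def by (cases "U = V") blast+
  have up: "card (up U) \<in> {1..nat \<lfloor>E\<rfloor>}" if "U \<in> A" for U
  proof -
    have "V \<sqsubseteq> W \<or> W \<sqsubseteq> V" if "V \<in> up U" "W \<in> up U" for V W
    proof -
      have "\<not> V \<bottom> W"
        using that orth_nest[of U V W] orth_not_comparable[of U W] unfolding up_def by blast
      then show ?thesis using cases that unfolding up_def by blast
    qed
    then have "nest_chain (up U)" using A(1) unfolding nest_chain_def up_def by blast
    moreover have "U \<in> up U" using that A(1) nest_refl unfolding up_def by blast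
    ultimately show ?thesis using nest_chain_finite card_gt_0_iff[of "up U"] by (auto simp: Suc_le_eq)
  qed
  have level: "card {U\<in>A. card (up U) = k} \<le> nat \<lfloor>E\<rfloor>" for k
  proof (rule orthogonal_bound)
    show "pairwise (\<bottom>) {U\<in>A. card (up U) = k}"
    proof (rule pairwiseI, rule ccontr)
      fix U V assume UV: "U \<in> {U\<in>A. card (up U) = k}" "V \<in> {U\<in>A. card (up U) = k}" "U \<noteq> V" "\<not> U \<bottom> V"
      have psub: "card (up V) < card (up U)" if "U \<sqsubseteq> V" "U \<noteq> V" "U \<in> A" for U V
      proof (rule psubset_card_mono)
        show "finite (up U)" using A(2) unfolding up_def by simp
        have "U \<in> up U" "U \<notin> up V" using that A(1) nest_refl nest_antisym unfolding up_def by blast+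
        moreover have "up V \<subseteq> up U" using nest_trans[OF that(1)] unfolding up_def by blast
        ultimately show "up V \<subset> up U" by blast
      qed
      have "U \<sqsubseteq> V \<or> V \<sqsubseteq> U" using cases UV by blast
      then show False using psub[of U V] psub[of V U] UV by auto
    qed
  qed (use A in auto)
  have "A = (\<Union>k\<in>{1..nat \<lfloor>E\<rfloor>}. {U\<in>A. card (up U) = k})" using up by auto
  then have "card A \<le> (\<Sum>k\<in>{1..nat \<lfloor>E\<rfloor>}. card {U\<in>A. card (up U) = k})"
    using card_UN_le[of "{1..nat \<lfloor>E\<rfloor>}" "\<lambda>k. {U\<in>A. card (up U) = k}"] by simp
  also have "\<dots> \<le> (\<Sum>k\<in>{1..nat \<lfloor>E\<rfloor>}. nat \<lfloor>E\<rfloor>)" by (rule sum_mono) (rule level)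
  finally show ?thesis by simp
qed

text \<open>Large links covers the relevant domains properly nested in \<open>T\<close> by boundedly
  many domains of smaller height, to which induction applies. The \<open>+ 1\<close> in the base of
  the power accounts for \<open>T\<close> itself.\<close>

lemma relevant_finite:
  assumes R: "\<forall>W\<in>\<SS>. proj_dist W x y \<le> R" and "T \<in> \<SS>" "height T \<le> n"
  shows "finite {U. U \<sqsubseteq> T \<and> E \<le> proj_dist U x y} \<and>
    card {U. U \<sqsubseteq> T \<and> E \<le> proj_dist U x y} \<le> (nat \<lfloor>E * R + E\<rfloor> + 1) ^ n"
  using assms(2,3)
proof (induction n arbitrary: T)
  case 0
  then show ?case using card_le_height[of "{T}" T] nest_refl[of T] by (simp add: nest_chain_def)
next
  case (Suc n)
  let ?m = "nat \<lfloor>E * R + E\<rfloor>" and ?F = "\<lambda>T. {U. U \<sqsubseteq> T \<and> E \<le> proj_dist U x y}"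
  from large_links[OF Suc.prems(1) refl, of x y] obtain \<T> where \<T>: "finite \<T>" "int (card \<T>) \<le> \<lfloor>E * proj_dist T x y + E\<rfloor>" "\<forall>T'\<in>\<T>. T' \<sqsubset> T"
    "\<forall>U. U \<sqsubset> T \<longrightarrow> (\<exists>T'\<in>\<T>. U \<sqsubseteq> T') \<or> proj_dist U x y < E"
    by (elim exE conjE)
  have IH: "finite (?F T') \<and> card (?F T') \<le> (?m + 1) ^ n" if "T' \<in> \<T>" for T'
  proof (rule Suc.IH)
    have "T' \<sqsubset> T" using \<T>(3) that by blast
    then show "T' \<in> \<SS>" using nest_in[of T' T] unfolding proper_nest_def by simp
    show "height T' \<le> n" using height_less[OF \<open>T' \<sqsubset> T\<close>] Suc.prems(2) by simp
  qed
  have "?F T \<subseteq> insert T (\<Union>T'\<in>\<T>. ?F T')"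
  proof
    fix U assume U: "U \<in> ?F T"
    show "U \<in> insert T (\<Union>T'\<in>\<T>. ?F T')"
    proof (cases "U = T")
      case False
      then have "U \<sqsubset> T" using U unfolding proper_nest_def by simp
      then have "\<exists>T'\<in>\<T>. U \<sqsubseteq> T'" using \<T>(4) U by force
      then show ?thesis using U by blast
    qed simp
  qed
  note sub = this
  have fin: "finite (\<Union>T'\<in>\<T>. ?F T')" using \<T>(1) IH by blast
  have card: "card (\<Union>T'\<in>\<T>. ?F T') \<le> ?m * (?m + 1) ^ n"
  proof -
    have "E * proj_dist T x y + E \<le> E * R + E"
      using R Suc.prems(1) E_ge_1 by (simp add: mult_left_mono)
    then have "\<lfloor>E * proj_dist T x y + E\<rfloor> \<le> \<lfloor>E * R + E\<rfloor>" by (rule floor_mono)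
    then have "card \<T> \<le> ?m" using \<T>(2) by linarith
    have "card (\<Union>T'\<in>\<T>. ?F T') \<le> (\<Sum>T'\<in>\<T>. card (?F T'))" by (rule card_UN_le[OF \<T>(1)])
    also have "\<dots> \<le> (\<Sum>T'\<in>\<T>. (?m + 1) ^ n)" using IH by (intro sum_mono) blast
    also have "\<dots> \<le> ?m * (?m + 1) ^ n" using \<open>card \<T> \<le> ?m\<close> by simp
    finally show ?thesis .
  qed
  have "finite (?F T)" using sub fin by (meson finite_insert finite_subset)
  moreover have "card (?F T) \<le> Suc (card (\<Union>T'\<in>\<T>. ?F T'))"
    using card_mono[OF _ sub] card_insert_le_m1 fin by (simp add: card_insert_if split: if_splits)
  moreover have "1 \<le> (?m + 1) ^ n" by simp
  ultimately have "finite (?F T) \<and> card (?F T) \<le> (?m + 1) ^ n + ?m * (?m + 1) ^ n"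
    using card by linarith
  then show ?case by simp
qed

end

section \<open>Hyperbolicity and transversality of the projections\<close>

lemma geodesic_segment_point:
  assumes "Metric_space M d" "a \<in> M" "b \<in> M" "geodesic_segment M d a b S" "p \<in> S"
  shows "p \<in> M" "d a p + d p b = d a b"
proof -
  obtain \<gamma> where \<gamma>: "\<forall>t\<in>{0..d a b}. \<gamma> t \<in> M"
    "\<forall>s\<in>{0..d a b}. \<forall>t\<in>{0..d a b}. d (\<gamma> s) (\<gamma> t) = \<bar>s - t\<bar>"
    "\<gamma> 0 = a" "\<gamma> (d a b) = b" "S = \<gamma> ` {0..d a b}"
    using assms(4) unfolding geodesic_segment_def by (elim exE conjE)
  then obtain t where t: "t \<in> {0..d a b}" "p = \<gamma> t" using assms(5) by blast
  then show "p \<in> M" using \<gamma>(1) by blast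
  have "0 \<in> {0..d a b}" "d a b \<in> {0..d a b}" using t(1) by auto
  then have "d (\<gamma> 0) (\<gamma> t) = t" "d (\<gamma> t) (\<gamma> (d a b)) = d a b - t"
    using \<gamma>(2) t(1) by simp_all
  then show "d a p + d p b = d a b" using \<gamma>(3,4) t(2) by simp
qed

context hhs
begin

lemma Metric_space_dC: "U \<in> \<SS> \<Longrightarrow> Metric_space (C U) (dC U)"
  using hyperbolic unfolding geodesic_hyperbolic_def geodesic_space_def by blast

text \<open>A triangle median lies on all three sides of the triangle, and by slimness each of its sides
  passes near one of the sides to any fourth point; this gives the four point inequality.\<close>

lemma hyperbolic_median_proj:
  assumes U: "U \<in> \<SS>"
    and med: "\<forall>x y z. coarse_triangle_median k (C U) (dC U) (\<pi> U x) (\<pi> U y) (\<pi> U z) (m x y z) \<and>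
      dC U (\<pi> U (\<mu> x y z)) (m x y z) \<le> k"
    and \<kappa>: "4 * k + 2 * E \<le> \<kappa>"
  shows "hyperbolic_median (proj_dist U) \<mu> \<kappa>"
proof -
  let ?C = "C U" and ?d = "dC U"
  interpret M: Metric_space ?C ?d by (rule Metric_space_dC[OF U])
  have geod: "\<exists>S. geodesic_segment ?C ?d a b S" if "a \<in> ?C" "b \<in> ?C" for a b
    using hyperbolic[OF U] that unfolding geodesic_hyperbolic_def geodesic_space_def by blast
  have near: "?d a w + ?d w b \<le> ?d a b + 2 * r"
    if "a \<in> ?C" "b \<in> ?C" "w \<in> ?C" "geodesic_segment ?C ?d a b S" "p \<in> S" "?d w p \<le> r" for a b w S p r
    using geodesic_segment_point[OF M.Metric_space_axioms that(1,2,4,5)] that(6)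
      M.triangle[of a p w] M.triangle[of w p b] M.commute[of w p] that(1-3) by simp
  have m: "m x y z \<in> ?C" "\<exists>P p. geodesic_segment ?C ?d (\<pi> U x) (\<pi> U y) P \<and> p \<in> P \<and> ?d (m x y z) p \<le> k"
    "?d (\<pi> U x) (m x y z) + ?d (m x y z) (\<pi> U y) \<le> ?d (\<pi> U x) (\<pi> U y) + 2 * k"
    "?d (\<pi> U y) (m x y z) + ?d (m x y z) (\<pi> U z) \<le> ?d (\<pi> U y) (\<pi> U z) + 2 * k"
    "?d (\<pi> U x) (m x y z) + ?d (m x y z) (\<pi> U z) \<le> ?d (\<pi> U x) (\<pi> U z) + 2 * k" for x y z
  proof -
    from med have "coarse_triangle_median k ?C ?d (\<pi> U x) (\<pi> U y) (\<pi> U z) (m x y z)" by simp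
    then obtain P Q R p q r where "m x y z \<in> ?C"
      and PQR: "geodesic_segment ?C ?d (\<pi> U x) (\<pi> U y) P" "geodesic_segment ?C ?d (\<pi> U y) (\<pi> U z) Q"
        "geodesic_segment ?C ?d (\<pi> U z) (\<pi> U x) R"
      and pqr: "p \<in> P" "?d (m x y z) p \<le> k" "q \<in> Q" "?d (m x y z) q \<le> k" "r \<in> R" "?d (m x y z) r \<le> k"
      unfolding coarse_triangle_median_def by auto
    note C = this(1) proj_in[OF U]
    show "m x y z \<in> ?C" by (rule C(1))
    show "\<exists>P p. geodesic_segment ?C ?d (\<pi> U x) (\<pi> U y) P \<and> p \<in> P \<and> ?d (m x y z) p \<le> k"
      using PQR pqr by blast
    show "?d (\<pi> U x) (m x y z) + ?d (m x y z) (\<pi> U y) \<le> ?d (\<pi> U x) (\<pi> U y) + 2 * k"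
      by (rule near[OF C(2,2,1) PQR(1) pqr(1,2)])
    show "?d (\<pi> U y) (m x y z) + ?d (m x y z) (\<pi> U z) \<le> ?d (\<pi> U y) (\<pi> U z) + 2 * k"
      by (rule near[OF C(2,2,1) PQR(2) pqr(3,4)])
    show "?d (\<pi> U x) (m x y z) + ?d (m x y z) (\<pi> U z) \<le> ?d (\<pi> U x) (\<pi> U z) + 2 * k"
      using near[OF C(2,2,1) PQR(3) pqr(5,6)] M.commute[of "\<pi> U x"] M.commute[of "m x y z" "\<pi> U z"]
      by simp
  qed
  show ?thesis
    unfolding proj_dist_def
  proof
    fix x y z a b p q
    show "0 \<le> ?d (\<pi> U x) (\<pi> U y)" by simp
    show "?d (\<pi> U x) (\<pi> U x) = 0" using proj_in[OF U] by simp
    show "?d (\<pi> U x) (\<pi> U y) = ?d (\<pi> U y) (\<pi> U x)" by (rule M.commute)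
    show "?d (\<pi> U x) (\<pi> U z) \<le> ?d (\<pi> U x) (\<pi> U y) + ?d (\<pi> U y) (\<pi> U z)"
      using proj_in[OF U] by (intro M.triangle)
    have close: "?d (\<pi> U (\<mu> x y z)) (m x y z) \<le> k" using med by blast
    have step: "?d u (\<pi> U (\<mu> x y z)) + ?d (\<pi> U (\<mu> x y z)) v \<le> ?d u v + \<kappa>"
      if "u \<in> ?C" "v \<in> ?C" "?d u (m x y z) + ?d (m x y z) v \<le> ?d u v + 2 * k" for u v
      using that(3) close M.triangle[OF that(1) m(1)[of x y z] proj_in[OF U, of "\<mu> x y z"]]
        M.triangle[OF proj_in[OF U, of "\<mu> x y z"] m(1)[of x y z] that(2)]
        M.commute[of "m x y z" "\<pi> U (\<mu> x y z)"] \<kappa> E_ge_1 by linarith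
    show "?d (\<pi> U x) (\<pi> U (\<mu> x y z)) + ?d (\<pi> U (\<mu> x y z)) (\<pi> U y) \<le> ?d (\<pi> U x) (\<pi> U y) + \<kappa>"
      "?d (\<pi> U y) (\<pi> U (\<mu> x y z)) + ?d (\<pi> U (\<mu> x y z)) (\<pi> U z) \<le> ?d (\<pi> U y) (\<pi> U z) + \<kappa>"
      "?d (\<pi> U x) (\<pi> U (\<mu> x y z)) + ?d (\<pi> U (\<mu> x y z)) (\<pi> U z) \<le> ?d (\<pi> U x) (\<pi> U z) + \<kappa>"
      by (rule step[OF proj_in[OF U] proj_in[OF U]], rule m)+
    let ?a = "\<pi> U a" and ?b = "\<pi> U b" and ?p = "\<pi> U p" and ?q = "\<pi> U q" and ?m = "m a b p"
    note in_C = proj_in[OF U, of a] proj_in[OF U, of b] proj_in[OF U, of p] proj_in[OF U, of q] m(1)[of a b p]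
    from m(2)[of a b p] obtain P w where P: "geodesic_segment ?C ?d ?a ?b P" "w \<in> P" "?d ?m w \<le> k"
      by (elim exE conjE)
    obtain Q where Q: "geodesic_segment ?C ?d ?b ?q Q" using geod[OF in_C(2,4)] by blast
    obtain R where R: "geodesic_segment ?C ?d ?q ?a R" using geod[OF in_C(4,1)] by blast
    have "\<forall>p\<in>P. \<exists>q\<in>Q \<union> R. ?d p q \<le> E"
      using hyperbolic[OF U] in_C P(1) Q R unfolding geodesic_hyperbolic_def by (elim conjE) simp
    then obtain v where v: "v \<in> Q \<union> R" "?d w v \<le> E" using P(2) by blast
    have "w \<in> ?C" by (rule geodesic_segment_point(1)[OF M.Metric_space_axioms in_C(1,2) P(1,2)])
    have "v \<in> ?C" using v(1)
      using geodesic_segment_point(1)[OF M.Metric_space_axioms in_C(2,4) Q]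
        geodesic_segment_point(1)[OF M.Metric_space_axioms in_C(4,1) R] by blast
    have mv: "?d ?m v \<le> k + E"
      using M.triangle[OF in_C(5) \<open>w \<in> ?C\<close> \<open>v \<in> ?C\<close>] P(3) v(2) by linarith
    have ab: "?d ?a ?b \<le> ?d ?a ?m + ?d ?m ?b" and pq: "?d ?p ?q \<le> ?d ?m ?p + ?d ?m ?q"
      using M.triangle[OF in_C(1,5,2)] M.triangle[OF in_C(3,5,4)] M.commute[of ?p ?m] by simp_all
    from v(1) show "?d ?a ?b + ?d ?p ?q \<le> max (?d ?a ?p + ?d ?b ?q) (?d ?a ?q + ?d ?b ?p) + \<kappa>"
    proof
      assume "v \<in> Q"
      from near[OF in_C(2,4,5) Q this mv] show ?thesis
        using ab pq m(5)[of a b p] M.commute[of ?b ?m] \<kappa>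
        unfolding distrib_left by linarith
    next
      assume "v \<in> R"
      from near[OF in_C(4,1,5) R this mv] show ?thesis
        using ab pq m(4)[of b a p] M.commute[of ?b ?m] M.commute[of ?a ?m]
          M.commute[of ?q ?m] M.commute[of ?q ?a] \<kappa>
        unfolding distrib_left by linarith
    qed
  qed
qed

text \<open>Infima need not be attained, so points of \<open>A\<close> are found within
  \<open>E + 1\<close> of both projections; the diameter of \<open>A\<close> adds
  \<open>E\<close>.\<close>

lemma proj_set_dist_near:
  assumes U: "U \<in> \<SS>" and A: "A \<noteq> {}" "A \<subseteq> C U" "diam_le (dC U) A E"
    and xy: "proj_set_dist U x A \<le> E" "proj_set_dist U y A \<le> E"
  shows "proj_dist U x y \<le> 3 * E + 2"
proof -
  interpret M: Metric_space "C U" "dC U" by (rule Metric_space_dC[OF U])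
  have "\<exists>a\<in>A. dC U (\<pi> U x) a < E + 1" if "proj_set_dist U x A \<le> E" for x
  proof -
    have "{dC U a b |a b. a \<in> {\<pi> U x} \<and> b \<in> A} \<noteq> {}" using A(1) by blast
    moreover have "Inf {dC U a b |a b. a \<in> {\<pi> U x} \<and> b \<in> A} < E + 1"
      using that unfolding proj_set_dist_def set_dist_def by simp
    ultimately obtain r where "r \<in> {dC U a b |a b. a \<in> {\<pi> U x} \<and> b \<in> A}" "r < E + 1"
      by (rule cInf_lessD[THEN bexE])
    then show ?thesis by auto
  qed
  from this[OF xy(1)] this[OF xy(2)] obtain a b
    where ab: "a \<in> A" "dC U (\<pi> U x) a < E + 1" "b \<in> A" "dC U (\<pi> U y) b < E + 1"
    by (elim bexE)
  have "dC U a b \<le> E" using A(3) ab(1,3) unfolding diam_le_def by simp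
  moreover have "a \<in> C U" "b \<in> C U" using A(2) ab(1,3) by (simp_all add: subsetD)
  ultimately show ?thesis
    using M.triangle[of "\<pi> U x" a "\<pi> U y"] M.triangle[of a b "\<pi> U y"] M.commute[of b "\<pi> U y"]
      proj_in[OF U] ab(2,4) unfolding proj_dist_def by simp
qed

lemma transverse_alternatives:
  assumes "transverse U V"
  shows "\<exists>P Q. (\<forall>x. P x \<or> Q x) \<and> (\<forall>x y. P x \<and> P y \<longrightarrow> proj_dist U x y \<le> 3 * E + 2) \<and>
    (\<forall>x y. Q x \<and> Q y \<longrightarrow> proj_dist V x y \<le> 3 * E + 2)"
proof (rule exI[of _ "\<lambda>x. proj_set_dist U x (\<rho> V U) \<le> E"],
    rule exI[of _ "\<lambda>x. proj_set_dist V x (\<rho> U V) \<le> E"], intro conjI allI impI; (elim conjE)?)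
  have UV: "U \<in> \<SS>" "V \<in> \<SS>" "transverse V U"
    using assms orth_sym unfolding transverse_def by auto
  show "proj_set_dist U x (\<rho> V U) \<le> E \<or> proj_set_dist V x (\<rho> U V) \<le> E" for x
    using transverse_consistency[OF assms, of x] by (simp add: min_le_iff_disj)
  show "proj_dist U x y \<le> 3 * E + 2"
    if "proj_set_dist U x (\<rho> V U) \<le> E" "proj_set_dist U y (\<rho> V U) \<le> E" for x y
    using transverse_rho[OF UV(3)] that by (intro proj_set_dist_near[OF UV(1)]) auto
  show "proj_dist V x y \<le> 3 * E + 2"
    if "proj_set_dist V x (\<rho> U V) \<le> E" "proj_set_dist V y (\<rho> U V) \<le> E" for x y
    using transverse_rho[OF assms] that by (intro proj_set_dist_near[OF UV(2)]) auto
qed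

theorem coarse_median_system_exists:
  assumes "hhs_coarse_median \<mu>"
  shows "\<exists>\<kappa> N. coarse_median_system \<SS> proj_dist \<mu> transverse \<kappa> N"
proof -
  obtain k m where med: "\<forall>U\<in>\<SS>. \<forall>x y z.
      coarse_triangle_median k (C U) (dC U) (\<pi> U x) (\<pi> U y) (\<pi> U z) (m U x y z) \<and>
      dC U (\<pi> U (\<mu> x y z)) (m U x y z) \<le> k"
    using assms unfolding hhs_coarse_median_def by (elim exE)
  \<comment> \<open>\<open>k\<close> comes without a sign, hence the absolute value.\<close>
  define \<kappa> where "\<kappa> = 4 * \<bar>k\<bar> + 3 * E + 2"
  have \<kappa>: "4 * k + 2 * E \<le> \<kappa>" "3 * E + 2 \<le> \<kappa>" "E \<le> \<kappa>" using E_ge_1 by (auto simp: \<kappa>_def)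
  have "coarse_median_system \<SS> proj_dist \<mu> transverse \<kappa> (nat \<lfloor>E\<rfloor> * nat \<lfloor>E\<rfloor>)"
  proof (rule coarse_median_system.intro)
    show "hyperbolic_median (proj_dist U) \<mu> \<kappa>" if "U \<in> \<SS>" for U
      using bspec[OF med that] by (rule hyperbolic_median_proj[OF that _ \<kappa>(1)])
    show "0 \<le> \<kappa>" using \<kappa>(3) E_ge_1 by simp
    show "proj_dist U x y \<le> \<kappa> * dist x y + \<kappa>" if "U \<in> \<SS>" for U x y
      using proj_coarsely_Lipschitz[OF that, of x y] mult_right_mono[OF \<kappa>(3) zero_le_dist[of x y]] \<kappa>(3)
      by linarith
    show "\<exists>P Q. (\<forall>x. P x \<or> Q x) \<and> (\<forall>x y. P x \<and> P y \<longrightarrow> proj_dist U x y \<le> \<kappa>) \<and>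
        (\<forall>x y. Q x \<and> Q y \<longrightarrow> proj_dist V x y \<le> \<kappa>)" if "transverse U V" for U V
    proof -
      from transverse_alternatives[OF that] obtain P Q where "\<forall>x. P x \<or> Q x"
        "\<forall>x y. P x \<and> P y \<longrightarrow> proj_dist U x y \<le> 3 * E + 2" "\<forall>x y. Q x \<and> Q y \<longrightarrow> proj_dist V x y \<le> 3 * E + 2"
        by (elim exE conjE)
      then show ?thesis using order_trans[OF _ \<kappa>(2)] by (intro exI[of _ P] exI[of _ Q]) simp
    qed
    show "card A \<le> nat \<lfloor>E\<rfloor> * nat \<lfloor>E\<rfloor>" if "A \<subseteq> \<SS>" "finite A" "pairwise (\<lambda>U V. \<not> transverse U V) A" for A
      using that by (rule nontransverse_bound)
    show "\<exists>n. \<forall>x y. (\<forall>W\<in>\<SS>. proj_dist W x y \<le> R) \<longrightarrow>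
        finite {T\<in>\<SS>. \<kappa> \<le> proj_dist T x y} \<and> card {T\<in>\<SS>. \<kappa> \<le> proj_dist T x y} \<le> n" for R
    proof (cases "\<SS> = {}")
      case False
      then obtain S where S: "S \<in> \<SS>" "\<forall>U\<in>\<SS>. U \<sqsubseteq> S" using exists_top by blast
      show ?thesis
      proof (intro exI allI impI)
        fix x y assume R: "\<forall>W\<in>\<SS>. proj_dist W x y \<le> R"
        let ?F = "{U. U \<sqsubseteq> S \<and> E \<le> proj_dist U x y}"
        have sub: "{T\<in>\<SS>. \<kappa> \<le> proj_dist T x y} \<subseteq> ?F" using S(2) order_trans[OF \<kappa>(3)] by auto
        note fin = relevant_finite[OF R S(1) height_le]
        show "finite {T\<in>\<SS>. \<kappa> \<le> proj_dist T x y} \<and>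
            card {T\<in>\<SS>. \<kappa> \<le> proj_dist T x y} \<le> (nat \<lfloor>E * R + E\<rfloor> + 1) ^ nat \<lfloor>E\<rfloor>"
          using fin finite_subset[OF sub] card_mono[OF _ sub] by force
      qed
    qed simp
    show "\<exists>\<theta>. \<forall>x y. (\<forall>V\<in>\<SS>. proj_dist V x y \<le> c) \<longrightarrow> dist x y \<le> \<theta>" for c
    proof -
      from uniqueness[of "max 0 (c + 1)"] obtain \<theta>
        where \<theta>: "\<forall>x y. \<theta> \<le> dist x y \<longrightarrow> (\<exists>V\<in>\<SS>. max 0 (c + 1) \<le> proj_dist V x y)" by auto
      have "dist x y \<le> \<theta>" if "\<forall>V\<in>\<SS>. proj_dist V x y \<le> c" for x y
      proof (rule ccontr)
        assume "\<not> dist x y \<le> \<theta>"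
        then have "\<exists>V\<in>\<SS>. max 0 (c + 1) \<le> proj_dist V x y" using \<theta> by simp
        then show False using that by fastforce
      qed
      then show ?thesis by blast
    qed
  qed
  then show ?thesis by blast
qed

end

theorem corollary3p6:
  fixes E K :: real
    and \<SS> :: "'s set"
    and nest orth :: "'s \<Rightarrow> 's \<Rightarrow> bool"
    and C :: "'s \<Rightarrow> 'c set"
    and dC :: "'s \<Rightarrow> 'c \<Rightarrow> 'c \<Rightarrow> real"
    and \<pi> :: "'s \<Rightarrow> 'x::metric_space \<Rightarrow> 'c"
    and \<rho> :: "'s \<Rightarrow> 's \<Rightarrow> 'c set"
    and \<rho>map :: "'s \<Rightarrow> 's \<Rightarrow> 'c \<Rightarrow> 'c"
    and \<mu> :: "'x \<Rightarrow> 'x \<Rightarrow> 'x \<Rightarrow> 'x"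
  assumes "hhs E \<SS> nest orth C dC \<pi> \<rho> \<rho>map"
    and "geodesic_space (UNIV :: 'x set) dist"
    and "hhs_data.hhs_coarse_median \<SS> C dC \<pi> \<mu>"
    and "K > 0"
  shows "coarsely_injective (UNIV :: 'x set) (contraction_metric K \<mu>) \<and>
         roughly_geodesic (UNIV :: 'x set) (contraction_metric K \<mu>)"
proof -
  interpret hhs E \<SS> nest orth C dC \<pi> \<rho> \<rho>map by (rule assms(1))
  obtain \<kappa> N where "coarse_median_system \<SS> proj_dist \<mu> transverse \<kappa> N"
    using coarse_median_system_exists[OF assms(3)] by (elim exE)
  then interpret contraction_system \<SS> proj_dist \<mu> transverse \<kappa> N K
    using assms(2,4)
    by (simp add: contraction_system_def contractions_def contraction_system_axioms_def)
  show ?thesis using coarsely_injective_sigma roughly_geodesic_sigma ..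
qed

end
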